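(* Let $\Omega\subset\mathbb{R}^N$, $N\ge2$, be a bounded domain of class $C^2$ and let $h:\Omega\times\mathbb{R}\to\mathbb{R}$, with $H(x,s):=\int_0^sh(x,\tau)\,d\tau$, satisfy: $(h_1)$ $h$ is a Carathéodory function and for every $\varrho>0$ there exists $\alpha_\varrho\in L^\infty(\Omega)$ such that $|h(x,s)|\le\alpha_\varrho(x)$ for a.e. $x\in\Omega$ and all $|s|\le\varrho$; $(h_2')$ $h(x,s)s>0$ for a.e. $x\in\Omega$ and all $s\ne0$. Let $\lambda\in\mathbb{R}$ be fixed and let $M>0$ be such that, for every $\mu\ge M$, $u_\mu$ is a solution of $$ -\operatorname{div}\left(\frac{\nabla u}{\sqrt{1-|\nabla u|^2}}\right)=\lambda u+\mu h(x,u)\ \text{ in }\Omega,\qquad u=0\ \text{ on }\partial\Omega, \tag{P$_\mu$} $$ and $$ \liminf_{\mu\to+\infty}I_\mu(u_\mu)>-\infty. $$ Then $u_\mu\to0$ uniformly in $\overline\Omega$ as $\mu\to+\infty$. In particular, if in addition $\lim_{s\to0}H(x,s)/s^2=0$ uniformly for a.e. $x\in\Omega$ and $\lambda$ is not an eigenvalue of the Dirichlet Laplacian in $\Omega$, the same conclusion holds for any family $\{u_\mu^{(s)}\}_{\mu>\bar\mu}$ (for some $\bar\mu\ge0$) of nontrivial solutions of (P$_\mu$) with $I_\mu(u_\mu^{(s)})>0$ for every $\mu>\bar\mu$.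
   Context: A solution of (P$_\mu$) is a function $u\in W^{2,q}(\Omega)$ for some $q>N$ such that $\|\nabla u\|_{L^\infty(\Omega)}<1$, $u$ satisfies the equation a.e. in $\Omega$, and $u$ vanishes on $\partial\Omega$. Set $K_0:=\{u\in W^{1,\infty}(\Omega):\|\nabla u\|_{L^\infty(\Omega)}\le1,\ u=0\text{ on }\partial\Omega\}$. For fixed $\lambda$, the functional $I_\mu:C(\overline\Omega)\to(-\infty,+\infty]$ is $$ I_\mu(u):=\Psi(u)-\frac\lambda2\int_\Omega u^2\,dx-\mu\int_\Omega H(x,u)\,dx, $$ where $\Psi(u):=\int_\Omega\left(1-\sqrt{1-|\nabla u|^2}\right)dx$ if $u\in K_0$ and $\Psi(u):=+\infty$ if $u\in C(\overline\Omega)\setminus K_0$. *)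

theory Defs
  imports "HOL-Analysis.Analysis" "HOL-Probability.Essential_Supremum"
begin

text \<open>Smoothness and domains in the Euclidean space \<open>'a\<close>, which plays the role of
  $\mathbb{R}^N$ with \<open>N = DIM('a)\<close>.\<close>

primrec C_k :: "nat \<Rightarrow> ('a::euclidean_space \<Rightarrow> real) \<Rightarrow> bool" where
  "C_k 0 f \<longleftrightarrow> continuous_on UNIV f"
| "C_k (Suc k) f \<longleftrightarrow>
     f differentiable_on UNIV \<and> (\<forall>i\<in>Basis. C_k k (\<lambda>x. frechet_derivative f (at x) i))"

definition test_function :: "'a::euclidean_space set \<Rightarrow> ('a \<Rightarrow> real) \<Rightarrow> bool" where
  "test_function \<Omega> \<phi> \<longleftrightarrow>
     (\<forall>k. C_k k \<phi>) \<and> (\<exists>K. compact K \<and> K \<subseteq> \<Omega> \<and> (\<forall>x. x \<notin> K \<longrightarrow> \<phi> x = 0))"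

definition grad :: "('a::euclidean_space \<Rightarrow> real) \<Rightarrow> 'a \<Rightarrow> 'a" where
  "grad \<phi> x = (\<Sum>i\<in>Basis. frechet_derivative \<phi> (at x) i *\<^sub>R i)"

text \<open>Near each boundary point the domain is the part strictly above the graph of a \<open>C\<^sup>2\<close>
  function, the height being measured along a unit vector \<open>e\<close>. The vector
  \<open>y - (y \<bullet> e) *\<^sub>R e\<close> is the projection of \<open>y\<close> to the hyperplane orthogonal
  to \<open>e\<close>, and only the restriction of \<open>g\<close> to that hyperplane matters; extending it to
  the whole space (constantly along \<open>e\<close>) is no restriction.\<close>

definition C2_boundary :: "'a::euclidean_space set \<Rightarrow> bool" where
  "C2_boundary \<Omega> \<longleftrightarrow>
     (\<forall>x\<in>frontier \<Omega>. \<exists>r>0. \<exists>e g. norm e = 1 \<and> C_k 2 g \<and>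
        \<Omega> \<inter> ball x r = {y \<in> ball x r. g (y - (y \<bullet> e) *\<^sub>R e) < y \<bullet> e})"

definition bounded_C2_domain :: "'a::euclidean_space set \<Rightarrow> bool" where
  "bounded_C2_domain \<Omega> \<longleftrightarrow>
     open \<Omega> \<and> connected \<Omega> \<and> \<Omega> \<noteq> {} \<and> bounded \<Omega> \<and> C2_boundary \<Omega>"


text \<open>Lebesgue and Sobolev spaces. Their elements are represented by functions on the whole
  space, of which only the values on \<open>\<Omega>\<close> matter.\<close>

definition Lp :: "real \<Rightarrow> 'a::euclidean_space set \<Rightarrow> ('a \<Rightarrow> 'b::euclidean_space) \<Rightarrow> bool" where
  "Lp p \<Omega> f \<longleftrightarrow> f \<in> borel_measurable (lebesgue_on \<Omega>) \<and>
     integrable (lebesgue_on \<Omega>) (\<lambda>x. norm (f x) powr p)"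

definition Linf_norm :: "'a::euclidean_space set \<Rightarrow> ('a \<Rightarrow> 'b::euclidean_space) \<Rightarrow> ereal" where
  "Linf_norm \<Omega> f = esssup (lebesgue_on \<Omega>) (\<lambda>x. ereal (norm (f x)))"

definition Linf :: "'a::euclidean_space set \<Rightarrow> ('a \<Rightarrow> 'b::euclidean_space) \<Rightarrow> bool" where
  "Linf \<Omega> f \<longleftrightarrow> f \<in> borel_measurable (lebesgue_on \<Omega>) \<and> Linf_norm \<Omega> f < \<infinity>"

definition locally_integrable :: "'a::euclidean_space set \<Rightarrow> ('a \<Rightarrow> real) \<Rightarrow> bool" where
  "locally_integrable \<Omega> f \<longleftrightarrow> (\<forall>K. compact K \<and> K \<subseteq> \<Omega> \<longrightarrow> f absolutely_integrable_on K)"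

definition has_weak_partial ::
  "'a::euclidean_space set \<Rightarrow> 'a \<Rightarrow> ('a \<Rightarrow> real) \<Rightarrow> ('a \<Rightarrow> real) \<Rightarrow> bool" where
  "has_weak_partial \<Omega> i u g \<longleftrightarrow> locally_integrable \<Omega> u \<and> locally_integrable \<Omega> g \<and>
     (\<forall>\<phi>. test_function \<Omega> \<phi> \<longrightarrow>
        (\<integral>x. u x * frechet_derivative \<phi> (at x) i \<partial>lebesgue_on \<Omega>) =
        - (\<integral>x. g x * \<phi> x \<partial>lebesgue_on \<Omega>))"

definition has_weak_grad ::
  "'a::euclidean_space set \<Rightarrow> ('a \<Rightarrow> real) \<Rightarrow> ('a \<Rightarrow> 'a) \<Rightarrow> bool" where
  "has_weak_grad \<Omega> u G \<longleftrightarrow> (\<forall>i\<in>Basis. has_weak_partial \<Omega> i u (\<lambda>x. G x \<bullet> i))"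

text \<open>A weak gradient is unique up to null sets, so the choice below is immaterial whenever a
  weak gradient exists.\<close>

definition weak_grad :: "'a::euclidean_space set \<Rightarrow> ('a \<Rightarrow> real) \<Rightarrow> 'a \<Rightarrow> 'a" where
  "weak_grad \<Omega> u = (SOME G. has_weak_grad \<Omega> u G)"

definition has_weak_div ::
  "'a::euclidean_space set \<Rightarrow> ('a \<Rightarrow> 'a) \<Rightarrow> ('a \<Rightarrow> real) \<Rightarrow> bool" where
  "has_weak_div \<Omega> F d \<longleftrightarrow>
     (\<exists>D. (\<forall>i\<in>Basis. has_weak_partial \<Omega> i (\<lambda>x. F x \<bullet> i) (D i)) \<and>
          d = (\<lambda>x. \<Sum>i\<in>Basis. D i x))"

definition W1inf :: "'a::euclidean_space set \<Rightarrow> ('a \<Rightarrow> real) \<Rightarrow> bool" where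
  "W1inf \<Omega> u \<longleftrightarrow> Linf \<Omega> u \<and> (\<exists>G. has_weak_grad \<Omega> u G \<and> Linf \<Omega> G)"

definition W2p :: "real \<Rightarrow> 'a::euclidean_space set \<Rightarrow> ('a \<Rightarrow> real) \<Rightarrow> bool" where
  "W2p q \<Omega> u \<longleftrightarrow> Lp q \<Omega> u \<and>
     (\<exists>G. has_weak_grad \<Omega> u G \<and> Lp q \<Omega> G \<and>
        (\<forall>i\<in>Basis. \<exists>G2. has_weak_grad \<Omega> (\<lambda>x. G x \<bullet> i) G2 \<and> Lp q \<Omega> G2))"

definition H10 :: "'a::euclidean_space set \<Rightarrow> ('a \<Rightarrow> real) \<Rightarrow> bool" where
  "H10 \<Omega> v \<longleftrightarrow> Lp 2 \<Omega> v \<and>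
     (\<exists>G. has_weak_grad \<Omega> v G \<and> Lp 2 \<Omega> G \<and>
        (\<exists>\<phi>. (\<forall>n::nat. test_function \<Omega> (\<phi> n)) \<and>
           (\<lambda>n. \<integral>x. (\<phi> n x - v x)\<^sup>2 \<partial>lebesgue_on \<Omega>) \<longlonglongrightarrow> 0 \<and>
           (\<lambda>n. \<integral>x. (norm (grad (\<phi> n) x - G x))\<^sup>2 \<partial>lebesgue_on \<Omega>) \<longlonglongrightarrow> 0))"

definition dirichlet_eigenvalue :: "'a::euclidean_space set \<Rightarrow> real \<Rightarrow> bool" where
  "dirichlet_eigenvalue \<Omega> lam \<longleftrightarrow>
     (\<exists>v. H10 \<Omega> v \<and> \<not> (AE x in lebesgue_on \<Omega>. v x = 0) \<and>
        (\<forall>w. H10 \<Omega> w \<longrightarrow>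
           (\<integral>x. weak_grad \<Omega> v x \<bullet> weak_grad \<Omega> w x \<partial>lebesgue_on \<Omega>) =
           lam * (\<integral>x. v x * w x \<partial>lebesgue_on \<Omega>)))"


definition caratheodory :: "'a::euclidean_space set \<Rightarrow> ('a \<Rightarrow> real \<Rightarrow> real) \<Rightarrow> bool" where
  "caratheodory \<Omega> h \<longleftrightarrow>
     (\<forall>s. (\<lambda>x. h x s) \<in> borel_measurable (lebesgue_on \<Omega>)) \<and>
     (AE x in lebesgue_on \<Omega>. continuous_on UNIV (h x))"

definition hyp_h1 :: "'a::euclidean_space set \<Rightarrow> ('a \<Rightarrow> real \<Rightarrow> real) \<Rightarrow> bool" where
  "hyp_h1 \<Omega> h \<longleftrightarrow> caratheodory \<Omega> h \<and>
     (\<forall>\<rho>>0. \<exists>\<alpha> :: 'a \<Rightarrow> real. Linf \<Omega> \<alpha> \<and>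
        (AE x in lebesgue_on \<Omega>. \<forall>s. \<bar>s\<bar> \<le> \<rho> \<longrightarrow> \<bar>h x s\<bar> \<le> \<alpha> x))"

definition hyp_h2' :: "'a::euclidean_space set \<Rightarrow> ('a \<Rightarrow> real \<Rightarrow> real) \<Rightarrow> bool" where
  "hyp_h2' \<Omega> h \<longleftrightarrow> (AE x in lebesgue_on \<Omega>. \<forall>s. s \<noteq> 0 \<longrightarrow> h x s * s > 0)"

text \<open>The interval integral is oriented, i.e. it changes sign for \<open>s < 0\<close>.\<close>

definition primitive :: "('a \<Rightarrow> real \<Rightarrow> real) \<Rightarrow> 'a \<Rightarrow> real \<Rightarrow> real" where
  "primitive h x s = (LBINT \<tau>=ereal 0..ereal s. h x \<tau>)"


text \<open>For \<open>q > N\<close> (and likewise for \<open>W\<^sup>1\<^sup>,\<^sup>\<infinity>\<close> on a \<open>C\<^sup>2\<close> domain) every Sobolev class has a unique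
  representative that is continuous up to the boundary. Solutions and elements of \<open>K0\<close> are
  taken to be these representatives, and the boundary condition is pointwise.\<close>

definition is_solution ::
  "'a::euclidean_space set \<Rightarrow> ('a \<Rightarrow> real \<Rightarrow> real) \<Rightarrow> real \<Rightarrow> real \<Rightarrow> ('a \<Rightarrow> real) \<Rightarrow> bool" where
  "is_solution \<Omega> h lam mu u \<longleftrightarrow>
     (\<exists>q > real DIM('a). W2p q \<Omega> u) \<and>
     continuous_on (closure \<Omega>) u \<and>
     Linf_norm \<Omega> (weak_grad \<Omega> u) < 1 \<and>
     (\<exists>d. has_weak_div \<Omega>
             (\<lambda>x. (1 / sqrt (1 - (norm (weak_grad \<Omega> u x))\<^sup>2)) *\<^sub>R weak_grad \<Omega> u x) d \<and>
          (AE x in lebesgue_on \<Omega>. - d x = lam * u x + mu * h x (u x))) \<and>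
     (\<forall>x\<in>frontier \<Omega>. u x = 0)"

definition K0 :: "'a::euclidean_space set \<Rightarrow> ('a \<Rightarrow> real) set" where
  "K0 \<Omega> = {u. continuous_on (closure \<Omega>) u \<and> W1inf \<Omega> u \<and>
              Linf_norm \<Omega> (weak_grad \<Omega> u) \<le> 1 \<and> (\<forall>x\<in>frontier \<Omega>. u x = 0)}"

definition Psi :: "'a::euclidean_space set \<Rightarrow> ('a \<Rightarrow> real) \<Rightarrow> ereal" where
  "Psi \<Omega> u = (if u \<in> K0 \<Omega>
     then ereal (\<integral>x. 1 - sqrt (1 - (norm (weak_grad \<Omega> u x))\<^sup>2) \<partial>lebesgue_on \<Omega>)
     else \<infinity>)"

definition energy ::
  "'a::euclidean_space set \<Rightarrow> ('a \<Rightarrow> real \<Rightarrow> real) \<Rightarrow> real \<Rightarrow> real \<Rightarrow> ('a \<Rightarrow> real) \<Rightarrow> ereal" where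
  "energy \<Omega> h lam mu u = Psi \<Omega> u
     - ereal (lam / 2 * (\<integral>x. (u x)\<^sup>2 \<partial>lebesgue_on \<Omega>))
     - ereal (mu * (\<integral>x. primitive h x (u x) \<partial>lebesgue_on \<Omega>))"

end

theory Submission
  imports Defs
begin

text \<open>Write \<open>H\<close> for \<open>primitive h\<close>. The proof is a concentration argument that rests on a Lipschitz
  bound common to all solutions.

  A solution has a weak gradient of norm at most \<open>1\<close> almost everywhere. Mollification turns this
  into the pointwise estimate \<open>\<bar>u q - u p\<bar> \<le> dist p q\<close> along segments in the domain
  (\<open>weak_grad_bound_imp_lipschitz\<close>). Together with the boundary condition it gives
  \<open>ball x \<bar>u x\<bar> \<subseteq> \<Omega>\<close> for every \<open>x \<in> \<Omega>\<close> (\<open>ball_abs_value_subset\<close>). Two facts follow. All solutions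
  are bounded by one constant. And a solution with \<open>\<bar>u x\<bar> \<ge> 2 * r\<close> satisfies \<open>u \<ge> r\<close> or \<open>u \<le> - r\<close>
  throughout \<open>ball x r\<close>.

  By the sign condition \<open>H x\<close> vanishes at \<open>0\<close>, is positive elsewhere and grows away from \<open>0\<close>. So a
  solution with \<open>\<bar>u x\<bar> \<ge> 2 * r\<close> makes the integral of \<open>H (\<cdot>, u)\<close> at least the integral of
  \<open>min (H y r) (H y (- r))\<close> over \<open>ball x r\<close>, and compactness of the closure bounds this below by some
  \<open>\<kappa> > 0\<close> that does not depend on \<open>x\<close> (\<open>integral_primitive_ge\<close>,
  \<open>integral_over_balls_bounded_below\<close>). On the other hand all terms of the energy other than the one
  with \<open>H\<close> are bounded uniformly in \<open>mu\<close> (\<open>energy_solution_le\<close>). If the energy stays bounded below, the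
  integral of \<open>H (\<cdot>, u)\<close> is therefore \<open>O(1 / mu)\<close>, so it drops below \<open>\<kappa>\<close>, and \<open>\<bar>u\<bar> < 2 * r\<close> for all large
  \<open>mu\<close>.

  The second part is the special case of the energy being bounded below by \<open>0\<close>.\<close>

section \<open>Smooth bump functions\<close>

text \<open>For \<open>m = 0\<close> this is the standard smooth function that is flat at \<open>0\<close>. Carrying the power \<open>m\<close>
  along makes the family closed under differentiation up to linear combinations, so that one
  derivative formula takes care of all orders.\<close>

definition flat_exp :: "nat \<Rightarrow> real \<Rightarrow> real" where
  "flat_exp m t = (if t \<le> 0 then 0 else exp (- (1 / t)) / t ^ m)"

lemma flat_exp_nonneg: "flat_exp m t \<ge> 0"
  by (simp add: flat_exp_def)

lemma flat_exp_tendsto_0: "(flat_exp m \<longlongrightarrow> 0) (at 0)"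
proof -
  \<comment> \<open>with \<open>s = 1 / t\<close> the function is \<open>s ^ m / exp s\<close>, and \<open>s\<close> tends to infinity\<close>
  have "((\<lambda>t. inverse t ^ m / exp (inverse t)) \<longlongrightarrow> (0::real)) (at_right 0)"
    using filterlim_compose[OF tendsto_power_div_exp_0 filterlim_inverse_at_top_right] .
  then have "(flat_exp m \<longlongrightarrow> 0) (at_right 0)"
    by (rule Lim_transform_eventually)
      (auto simp: flat_exp_def eventually_at_filter exp_minus field_simps)
  moreover have "(flat_exp m \<longlongrightarrow> 0) (at_left 0)"
    by (rule Lim_transform_eventually[OF tendsto_const])
      (auto simp: flat_exp_def eventually_at_filter)
  ultimately show ?thesis
    by (simp add: filterlim_at_split)
qed

lemma DERIV_flat_exp:
  "(flat_exp m has_real_derivative flat_exp (m + 2) t - real m * flat_exp (m + 1) t) (at t)"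
proof (cases t "0::real" rule: linorder_cases)
  case less
  have "((\<lambda>t. 0) has_real_derivative 0) (at t)" by simp
  moreover have "eventually (\<lambda>s. (0::real) = flat_exp m s) (nhds t)"
    using eventually_nhds_in_open[of "{..<0}" t] less
    by (auto elim!: eventually_mono simp: flat_exp_def)
  ultimately have "(flat_exp m has_real_derivative 0) (at t)"
    by (subst (asm) DERIV_cong_ev[OF refl _ refl]) auto
  then show ?thesis using less by (simp add: flat_exp_def)
next
  case greater
  have "((\<lambda>t. exp (- (1 / t)) / t ^ m) has_real_derivative
      ((exp (- (1/t)) * (1/t^2)) * t^m - exp (- (1/t)) * (real m * t^(m-1))) / (t^m * t^m)) (at t)"
    using greater by (auto intro!: derivative_eq_intros simp: power2_eq_square field_simps)
  moreover have "((exp (- (1/t)) * (1/t^2)) * t^m - exp (- (1/t)) * (real m * t^(m-1))) / (t^m * t^m)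
      = flat_exp (m + 2) t - real m * flat_exp (m + 1) t"
    using greater by (cases m) (auto simp: flat_exp_def field_simps power2_eq_square)
  moreover have "eventually (\<lambda>s. exp (- (1 / s)) / s ^ m = flat_exp m s) (nhds t)"
    using eventually_nhds_in_open[of "{0<..}" t] greater
    by (auto elim!: eventually_mono simp: flat_exp_def)
  ultimately show ?thesis
    by (subst (asm) DERIV_cong_ev[OF refl _ refl]) auto
next
  case equal
  \<comment> \<open>the difference quotient at \<open>0\<close> is the member of index \<open>m + 1\<close> of the same family\<close>
  have "((\<lambda>s. flat_exp m s / s) \<longlongrightarrow> 0) (at 0)"
    by (rule Lim_transform_eventually[OF flat_exp_tendsto_0[of "Suc m"]])
      (auto simp: flat_exp_def eventually_at_filter)
  then have "(flat_exp m has_real_derivative 0) (at 0)"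
    by (simp add: has_field_derivative_iff flat_exp_def)
  then show ?thesis using equal by (simp add: flat_exp_def)
qed

lemma continuous_flat_exp: "continuous_on UNIV (flat_exp m)"
  using DERIV_flat_exp DERIV_isCont continuous_at_imp_continuous_on by blast

definition bump :: "real \<Rightarrow> 'a::euclidean_space \<Rightarrow> 'a \<Rightarrow> real" where
  "bump \<delta> p z = flat_exp 0 (\<delta>\<^sup>2 - (z - p) \<bullet> (z - p))"

text \<open>Smoothness of \<open>bump \<delta> p\<close> requires iterated partial derivatives of every order. Instead of
  computing them, one places the function in an algebra of functions that is closed under partial
  derivatives: such an algebra consists of smooth functions only.\<close>

inductive_set bump_algebra :: "real \<Rightarrow> 'a::euclidean_space \<Rightarrow> ('a \<Rightarrow> real) set"
  for \<delta> p where
  const: "(\<lambda>z. c) \<in> bump_algebra \<delta> p"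
| coord: "(\<lambda>z. (z - p) \<bullet> i) \<in> bump_algebra \<delta> p"
| flat: "(\<lambda>z. flat_exp m (\<delta>\<^sup>2 - (z - p) \<bullet> (z - p))) \<in> bump_algebra \<delta> p"
| add: "f \<in> bump_algebra \<delta> p \<Longrightarrow> g \<in> bump_algebra \<delta> p \<Longrightarrow> (\<lambda>z. f z + g z) \<in> bump_algebra \<delta> p"
| mult: "f \<in> bump_algebra \<delta> p \<Longrightarrow> g \<in> bump_algebra \<delta> p \<Longrightarrow> (\<lambda>z. f z * g z) \<in> bump_algebra \<delta> p"

lemma has_derivative_flat_exp_sphere:
  "((\<lambda>z. flat_exp m (c - (z - p) \<bullet> (z - p))) has_derivative
     (\<lambda>v. (flat_exp (m + 2) (c - (z - p) \<bullet> (z - p))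
            - real m * flat_exp (m + 1) (c - (z - p) \<bullet> (z - p))) * (- 2 * ((z - p) \<bullet> v)))) (at z)"
proof -
  have "((\<lambda>z. c - (z - p) \<bullet> (z - p)) has_derivative (\<lambda>v. - 2 * ((z - p) \<bullet> v))) (at z)"
    by (auto intro!: derivative_eq_intros simp: inner_commute)
  from has_derivative_compose[OF this DERIV_flat_exp[unfolded has_field_derivative_def]]
  show ?thesis by simp
qed

lemma bump_algebra_derivative:
  assumes "f \<in> bump_algebra \<delta> p"
  shows "\<exists>f'. (\<forall>z. (f has_derivative f' z) (at z)) \<and> (\<forall>i. (\<lambda>z. f' z i) \<in> bump_algebra \<delta> p)"
  using assms
proof induction
  case (const c)
  show ?case
    by (rule exI[of _ "\<lambda>z v. 0"]) (auto intro: bump_algebra.const)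
next
  case (coord i)
  have "((\<lambda>z. (z - p) \<bullet> i) has_derivative (\<lambda>v. v \<bullet> i)) (at z)" for z
    by (auto intro!: derivative_eq_intros)
  then show ?case
    by (intro exI[of _ "\<lambda>z v. v \<bullet> i"]) (auto intro: bump_algebra.const)
next
  case (flat m)
  have "(\<lambda>z. (flat_exp (m + 2) (\<delta>\<^sup>2 - (z - p) \<bullet> (z - p))
            + (- real m) * flat_exp (m + 1) (\<delta>\<^sup>2 - (z - p) \<bullet> (z - p))) * (- 2 * ((z - p) \<bullet> v)))
      \<in> bump_algebra \<delta> p" for v
    by (intro bump_algebra.intros)
  then show ?case
    using has_derivative_flat_exp_sphere[of m "\<delta>\<^sup>2" p]
    by (intro exI[of _ "\<lambda>z v. (flat_exp (m + 2) (\<delta>\<^sup>2 - (z - p) \<bullet> (z - p))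
            - real m * flat_exp (m + 1) (\<delta>\<^sup>2 - (z - p) \<bullet> (z - p))) * (- 2 * ((z - p) \<bullet> v))"]) auto
next
  case (add f g)
  then obtain f' g' where
    "\<And>z. (f has_derivative f' z) (at z)" "\<And>i. (\<lambda>z. f' z i) \<in> bump_algebra \<delta> p"
    "\<And>z. (g has_derivative g' z) (at z)" "\<And>i. (\<lambda>z. g' z i) \<in> bump_algebra \<delta> p"
    by blast
  then show ?case
    by (intro exI[of _ "\<lambda>z v. f' z v + g' z v"]) (auto intro: bump_algebra.intros has_derivative_add)
next
  case (mult f g)
  then obtain f' g' where
    "\<And>z. (f has_derivative f' z) (at z)" "\<And>i. (\<lambda>z. f' z i) \<in> bump_algebra \<delta> p"
    "\<And>z. (g has_derivative g' z) (at z)" "\<And>i. (\<lambda>z. g' z i) \<in> bump_algebra \<delta> p"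
    by blast
  then show ?case using mult.hyps
    by (intro exI[of _ "\<lambda>z v. f z * g' z v + f' z v * g z"])
       (auto intro!: bump_algebra.add bump_algebra.mult has_derivative_mult)
qed

text \<open>Differentiability gives continuity, and the partial derivatives lie in the algebra
  again, so induction on the order applies to all members at once.\<close>

lemma bump_algebra_C_k: "f \<in> bump_algebra \<delta> p \<Longrightarrow> C_k k f"
proof (induction k arbitrary: f)
  case 0
  obtain f' where "\<And>z. (f has_derivative f' z) (at z)"
    using bump_algebra_derivative[OF 0] by blast
  then show ?case
    by (auto intro!: continuous_at_imp_continuous_on has_derivative_continuous)
next
  case (Suc k)
  obtain f' where f': "\<And>z. (f has_derivative f' z) (at z)" "\<And>i. (\<lambda>z. f' z i) \<in> bump_algebra \<delta> p"
    using bump_algebra_derivative[OF Suc.prems] by blast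
  have "frechet_derivative f (at z) = f' z" for z
    using frechet_derivative_at[OF f'(1)] by simp
  then show ?case
    using f' Suc.IH by (auto simp: differentiable_on_def differentiable_def intro: has_derivative_at_withinI)
qed

lemma bump_nonneg: "bump \<delta> p z \<ge> 0"
  by (simp add: bump_def flat_exp_nonneg)

lemma bump_pos: "dist p z < \<delta> \<Longrightarrow> bump \<delta> p z > 0"
  using power_strict_mono[of "dist p z" \<delta> 2]
  by (simp add: bump_def flat_exp_def dot_square_norm dist_norm norm_minus_commute)

lemma bump_eq_0: "dist p z > \<delta> \<Longrightarrow> \<delta> \<ge> 0 \<Longrightarrow> bump \<delta> p z = 0"
  by (simp add: bump_def flat_exp_def dot_square_norm power_mono dist_norm norm_minus_commute)

lemma continuous_on_bump: "continuous_on UNIV (bump \<delta> p)"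
  unfolding bump_def
  by (rule continuous_on_compose2[OF continuous_flat_exp]) (auto intro!: continuous_intros)

lemma test_function_bump:
  assumes "\<delta> \<ge> 0" "cball p \<delta> \<subseteq> \<Omega>"
  shows "test_function \<Omega> (bump \<delta> p)"
proof -
  have "C_k k (bump \<delta> p)" for k
    unfolding bump_def[abs_def] by (rule bump_algebra_C_k[OF bump_algebra.flat])
  then show ?thesis
    unfolding test_function_def using assms bump_eq_0
    by (metis compact_cball mem_cball not_le)
qed

definition bump_deriv :: "real \<Rightarrow> 'a::euclidean_space \<Rightarrow> 'a \<Rightarrow> 'a \<Rightarrow> real" where
  "bump_deriv \<delta> p z v = flat_exp 2 (\<delta>\<^sup>2 - (z - p) \<bullet> (z - p)) * (- 2 * ((z - p) \<bullet> v))"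

lemma has_derivative_bump: "(bump \<delta> p has_derivative bump_deriv \<delta> p z) (at z)"
  using has_derivative_flat_exp_sphere[of 0 "\<delta>\<^sup>2" p z]
  by (simp add: bump_def[abs_def] bump_deriv_def[abs_def] numeral_2_eq_2)

lemma bump_translation: "bump \<delta> p z = bump \<delta> 0 (z - p)"
  by (simp add: bump_def)

lemma has_vector_derivative_bump_path:
  "((\<lambda>t. bump \<delta> (p + t *\<^sub>R v) z) has_vector_derivative - bump_deriv \<delta> (p + t *\<^sub>R v) z v) (at t within T)"
proof -
  have "((\<lambda>t. z - (p + t *\<^sub>R v)) has_derivative (\<lambda>s. - (s *\<^sub>R v))) (at t within T)"
    by (auto intro!: derivative_eq_intros)
  from has_derivative_compose[OF this has_derivative_bump[of \<delta> 0]]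
  have "((\<lambda>t. bump \<delta> (p + t *\<^sub>R v) z) has_derivative
      (\<lambda>s. bump_deriv \<delta> 0 (z - (p + t *\<^sub>R v)) (- (s *\<^sub>R v)))) (at t within T)"
    by (simp add: bump_translation[of \<delta> "p + _ *\<^sub>R v" z])
  then show ?thesis
    by (simp add: has_vector_derivative_def bump_deriv_def algebra_simps)
qed

section \<open>Functions with bounded weak gradient are Lipschitz\<close>

lemma integral_compact_support:
  fixes f :: "'a::euclidean_space \<Rightarrow> real"
  assumes "f absolutely_integrable_on K" "K \<in> sets lebesgue" "S \<in> sets lebesgue"
    and "K \<subseteq> S" "K \<subseteq> T" "\<And>z. z \<notin> K \<Longrightarrow> f z = 0"
  shows "integrable (lebesgue_on S) f" "integral\<^sup>L (lebesgue_on S) f = integral T f"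
proof -
  have "f absolutely_integrable_on S"
    using assms(1)
    by (subst absolutely_integrable_spike_set_eq[of S K])
       (use assms in \<open>auto intro: negligible_subset[OF negligible_empty]\<close>)
  then show int: "integrable (lebesgue_on S) f"
    using assms(3) by (rule absolutely_integrable_imp_integrable)
  have "(f has_integral integral K f) K"
    using assms(1) by (simp add: absolutely_integrable_on_def integrable_integral)
  then have "(f has_integral integral K f) S" "(f has_integral integral K f) T"
    using assms(4-6) by (auto intro: has_integral_on_superset)
  then show "integral\<^sup>L (lebesgue_on S) f = integral T f"
    using lebesgue_integral_eq_integral[OF int assms(3)] by (simp add: integral_unique)
qed

lemma absolutely_integrable_mult_continuous:
  fixes f g :: "'a::euclidean_space \<Rightarrow> real"
  assumes "f absolutely_integrable_on K" "compact K" "continuous_on K g"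
  shows "(\<lambda>z. f z * g z) absolutely_integrable_on K"
proof -
  have "(\<lambda>z. g z * f z) absolutely_integrable_on K"
    using assms
    by (intro absolutely_integrable_bounded_measurable_product[OF bilinear_times])
       (auto intro!: continuous_imp_measurable_on_sets_lebesgue compact_imp_bounded
             compact_continuous_image simp: lmeasurable_compact fmeasurableD)
  then show ?thesis by (simp add: mult.commute)
qed

lemma continuous_on_bump_deriv: "continuous_on UNIV (\<lambda>z. bump_deriv \<delta> p z v)"
  unfolding bump_deriv_def
  by (intro continuous_intros continuous_on_compose2[OF continuous_flat_exp]) auto

lemma bump_deriv_eq_0:
  assumes "dist p z > \<delta>" "\<delta> \<ge> 0"
  shows "bump_deriv \<delta> p z v = 0"
  using power_mono[of \<delta> "dist p z" 2] assms
  by (simp add: bump_deriv_def flat_exp_def dot_square_norm dist_norm norm_minus_commute)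

lemma bump_deriv_euclidean: "bump_deriv \<delta> p z v = (\<Sum>i\<in>Basis. (v \<bullet> i) * bump_deriv \<delta> p z i)"
  unfolding bump_deriv_def euclidean_inner[of "z - p" v]
  by (simp add: sum_distrib_left sum_distrib_right mult_ac)

text \<open>The mass of a bump depends on the radius and the dimension only, not on the centre. The type
  argument records the space, which the radius does not determine.\<close>

definition bump_mass :: "'a::euclidean_space itself \<Rightarrow> real \<Rightarrow> real" where
  "bump_mass _ \<delta> = integral UNIV (bump \<delta> (0::'a))"

lemma has_integral_support_iff:
  fixes f :: "'a::euclidean_space \<Rightarrow> real"
  assumes "\<And>z. z \<notin> S \<Longrightarrow> f z = 0"
  shows "(f has_integral I) S \<longleftrightarrow> (f has_integral I) UNIV"
proof -
  have "(\<lambda>z. if z \<in> S then f z else 0) = f" using assms by auto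
  then show ?thesis using has_integral_restrict_UNIV[of S f I] by simp
qed

lemma has_integral_bump:
  fixes p :: "'a::euclidean_space"
  assumes "cball p \<delta> \<subseteq> T" "\<delta> \<ge> 0"
  shows "(bump \<delta> p has_integral bump_mass TYPE('a) \<delta>) T"
proof -
  have supp: "(bump \<delta> q has_integral I) S \<longleftrightarrow> (bump \<delta> q has_integral I) UNIV"
    if "cball q \<delta> \<subseteq> S" for q :: 'a and S I
    using that assms(2) by (intro has_integral_support_iff bump_eq_0) (auto simp: subset_eq not_le[symmetric])
  have bdd: "bounded (cball p \<delta> \<union> cball 0 \<delta>)" by simp
  obtain a :: 'a where a: "cball p \<delta> \<union> cball 0 \<delta> \<subseteq> cbox (- a) a"
    using bounded_subset_cbox_symmetric[OF bdd] by metis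
  have sub0: "cball p \<delta> \<subseteq> cbox (- a + p) (a + p)"
  proof
    fix z assume "z \<in> cball p \<delta>"
    then have "z - p \<in> cball 0 \<delta>" by (simp add: dist_norm norm_minus_commute)
    then have "z - p \<in> cbox (- a) a" using a by blast
    then show "z \<in> cbox (- a + p) (a + p)" by (auto simp: mem_box algebra_simps)
  qed
  have "bump \<delta> p integrable_on cbox (- a + p) (a + p)"
    by (intro integrable_continuous continuous_on_subset[OF continuous_on_bump]) auto
  then have 1: "(bump \<delta> p has_integral integral (cbox (- a + p) (a + p)) (bump \<delta> p)) (cbox (- a + p) (a + p))"
    by (rule integrable_integral)
  have "((\<lambda>z. bump \<delta> p (z + p)) has_integral integral (cbox (- a + p) (a + p)) (bump \<delta> p)) (cbox (- a) a)"
    using has_integral_shift_cbox[OF 1, of p] by simp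
  then have "(bump \<delta> 0 has_integral integral (cbox (- a + p) (a + p)) (bump \<delta> p)) (cbox (- a) a)"
    by (simp add: bump_translation[of \<delta> p])
  then have "(bump \<delta> (0::'a) has_integral integral (cbox (- a + p) (a + p)) (bump \<delta> p)) UNIV"
    using a by (subst (asm) supp) auto
  then have "integral (cbox (- a + p) (a + p)) (bump \<delta> p) = bump_mass TYPE('a) \<delta>"
    unfolding bump_mass_def by (simp add: integral_unique)
  then show ?thesis
    using 1 supp[OF sub0] supp[OF assms(1)] by simp
qed

text \<open>A continuous nonnegative function with vanishing integral is zero, but the bump is positive at
  its centre.\<close>

lemma bump_mass_pos:
  assumes "\<delta> > 0"
  shows "bump_mass TYPE('a::euclidean_space) \<delta> > 0"
proof -
  obtain a b :: 'a where ab: "cball 0 \<delta> \<subseteq> cbox a b"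
    using bounded_subset_cbox_symmetric[OF bounded_cball] by metis
  have int: "(bump \<delta> 0 has_integral bump_mass TYPE('a) \<delta>) (cbox a b)"
    using has_integral_bump[OF ab] assms by simp
  have "bump_mass TYPE('a) \<delta> \<ge> 0"
    using int by (rule has_integral_nonneg) (simp add: bump_nonneg)
  moreover have "bump_mass TYPE('a) \<delta> \<noteq> 0"
  proof
    assume "bump_mass TYPE('a) \<delta> = 0"
    then have 0: "(bump \<delta> 0 has_integral 0) (cbox a b)" using int by simp
    have "cball 0 \<delta> \<subseteq> cbox a b" "(0::'a) \<in> ball 0 \<delta>" using ab assms by auto
    then have "(0::'a) \<in> interior (cbox a b)"
      by (meson ball_subset_cball interior_maximal open_ball order_trans subsetD)
    then have ne: "box a b \<noteq> {}" by (metis empty_iff interior_cbox)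
    have "bump \<delta> 0 (0::'a) = 0"
      by (rule has_integral_0_cbox_imp_0[OF continuous_on_subset[OF continuous_on_bump] _ 0 ne])
         (use \<open>(0::'a) \<in> interior (cbox a b)\<close> interior_subset[of "cbox a b"] in \<open>auto simp: bump_nonneg\<close>)
    then show False using bump_pos[of "0::'a" 0 \<delta>] assms by simp
  qed
  ultimately show ?thesis by simp
qed

text \<open>The defining identity of the weak gradient, tested against a bump and summed over the coordinate
  directions with the weights \<open>v \<bullet> i\<close>.\<close>

lemma weak_grad_bump:
  assumes "has_weak_grad \<Omega> u G" "open \<Omega>" "cball p \<delta> \<subseteq> \<Omega>" "\<delta> \<ge> 0"
  shows "integrable (lebesgue_on \<Omega>) (\<lambda>z. (G z \<bullet> v) * bump \<delta> p z)"
    and "(\<integral>z. u z * bump_deriv \<delta> p z v \<partial>lebesgue_on \<Omega>)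
       = - (\<integral>z. (G z \<bullet> v) * bump \<delta> p z \<partial>lebesgue_on \<Omega>)"
proof -
  have \<Omega>: "\<Omega> \<in> sets lebesgue" using assms(2) by auto
  have weak: "has_weak_partial \<Omega> i u (\<lambda>x. G x \<bullet> i)" if "i \<in> Basis" for i
    using assms(1) that by (simp add: has_weak_grad_def)
  obtain b :: 'a where "b \<in> Basis" using nonempty_Basis by blast
  have u: "u absolutely_integrable_on cball p \<delta>"
    using weak[OF \<open>b \<in> Basis\<close>] assms(3) by (auto simp: has_weak_partial_def locally_integrable_def)
  have G: "(\<lambda>x. G x \<bullet> i) absolutely_integrable_on cball p \<delta>" if "i \<in> Basis" for i
    using weak[OF that] assms(3) by (auto simp: has_weak_partial_def locally_integrable_def)
  have iu: "integrable (lebesgue_on \<Omega>) (\<lambda>z. u z * bump_deriv \<delta> p z i)" for i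
    by (rule integral_compact_support(1)[where K = "cball p \<delta>" and T = "cball p \<delta>"])
       (use assms \<Omega> u in \<open>auto intro!: absolutely_integrable_mult_continuous
          continuous_on_subset[OF continuous_on_bump_deriv] simp: bump_deriv_eq_0 not_le\<close>)
  have iG: "integrable (lebesgue_on \<Omega>) (\<lambda>z. (G z \<bullet> i) * bump \<delta> p z)" if "i \<in> Basis" for i
    by (rule integral_compact_support(1)[where K = "cball p \<delta>" and T = "cball p \<delta>"])
       (use assms \<Omega> G[OF that] in \<open>auto intro!: absolutely_integrable_mult_continuous
          continuous_on_subset[OF continuous_on_bump] simp: bump_eq_0 not_le\<close>)
  have part: "(\<integral>z. u z * bump_deriv \<delta> p z i \<partial>lebesgue_on \<Omega>)
       = - (\<integral>z. (G z \<bullet> i) * bump \<delta> p z \<partial>lebesgue_on \<Omega>)" if "i \<in> Basis" for i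
  proof -
    have "frechet_derivative (bump \<delta> p) (at z) = bump_deriv \<delta> p z" for z
      using frechet_derivative_at[OF has_derivative_bump] by metis
    then show ?thesis
      using weak[OF that] test_function_bump[OF assms(4,3)] by (auto simp: has_weak_partial_def)
  qed
  have expand: "(\<lambda>z. (G z \<bullet> v) * bump \<delta> p z) = (\<lambda>z. \<Sum>i\<in>Basis. (v \<bullet> i) * ((G z \<bullet> i) * bump \<delta> p z))"
    by (rule ext) (simp add: euclidean_inner[of _ v] sum_distrib_right sum_distrib_left mult_ac)
  show "integrable (lebesgue_on \<Omega>) (\<lambda>z. (G z \<bullet> v) * bump \<delta> p z)"
    unfolding expand using iG by (intro Bochner_Integration.integrable_sum integrable_mult_right) auto
  have "(\<integral>z. u z * bump_deriv \<delta> p z v \<partial>lebesgue_on \<Omega>)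
      = (\<integral>z. (\<Sum>i\<in>Basis. (v \<bullet> i) * (u z * bump_deriv \<delta> p z i)) \<partial>lebesgue_on \<Omega>)"
    by (subst bump_deriv_euclidean) (simp add: sum_distrib_left mult_ac)
  also have "\<dots> = (\<Sum>i\<in>Basis. (v \<bullet> i) * (\<integral>z. u z * bump_deriv \<delta> p z i \<partial>lebesgue_on \<Omega>))"
    using iu by (subst Bochner_Integration.integral_sum) auto
  also have "\<dots> = - (\<Sum>i\<in>Basis. (v \<bullet> i) * (\<integral>z. (G z \<bullet> i) * bump \<delta> p z \<partial>lebesgue_on \<Omega>))"
    by (simp add: part sum_negf)
  also have "(\<Sum>i\<in>Basis. (v \<bullet> i) * (\<integral>z. (G z \<bullet> i) * bump \<delta> p z \<partial>lebesgue_on \<Omega>))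
      = (\<integral>z. (G z \<bullet> v) * bump \<delta> p z \<partial>lebesgue_on \<Omega>)"
    unfolding expand using iG by (subst Bochner_Integration.integral_sum) auto
  finally show "(\<integral>z. u z * bump_deriv \<delta> p z v \<partial>lebesgue_on \<Omega>)
       = - (\<integral>z. (G z \<bullet> v) * bump \<delta> p z \<partial>lebesgue_on \<Omega>)" .
qed

text \<open>The left-hand side is, up to sign, the derivative in direction \<open>v\<close> of the mollification of \<open>u\<close>
  at \<open>p\<close>. Moving the derivative to the weak gradient turns it into an average of \<open>G \<bullet> v\<close>, so it
  inherits the bound of \<open>G\<close>.\<close>

lemma weak_grad_bump_bound:
  fixes \<Omega> :: "'a::euclidean_space set"
  assumes "has_weak_grad \<Omega> u G" "open \<Omega>" "cball p \<delta> \<subseteq> \<Omega>" "\<delta> \<ge> 0"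
    and "AE x in lebesgue_on \<Omega>. norm (G x) \<le> L"
  shows "\<bar>\<integral>z. u z * bump_deriv \<delta> p z v \<partial>lebesgue_on \<Omega>\<bar> \<le> L * norm v * bump_mass TYPE('a) \<delta>"
proof -
  have \<Omega>: "\<Omega> \<in> sets lebesgue" using assms(2) by auto
  have "bump \<delta> p absolutely_integrable_on cball p \<delta>"
    using has_integral_bump[of p \<delta> "cball p \<delta>"] assms(4)
    by (intro nonnegative_absolutely_integrable_1) (auto simp: bump_nonneg integrable_on_def)
  note bump = integral_compact_support[OF this _ \<Omega> assms(3) assms(3) bump_eq_0]
  have bump: "integrable (lebesgue_on \<Omega>) (bump \<delta> p)"
      "integral\<^sup>L (lebesgue_on \<Omega>) (bump \<delta> p) = bump_mass TYPE('a) \<delta>"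
    using bump assms(4) integral_unique[OF has_integral_bump[OF assms(3,4)]] by auto
  have "\<bar>\<integral>z. u z * bump_deriv \<delta> p z v \<partial>lebesgue_on \<Omega>\<bar>
      = norm (\<integral>z. (G z \<bullet> v) * bump \<delta> p z \<partial>lebesgue_on \<Omega>)"
    using weak_grad_bump(2)[OF assms(1-4)] by simp
  also have "\<dots> \<le> (\<integral>z. norm ((G z \<bullet> v) * bump \<delta> p z) \<partial>lebesgue_on \<Omega>)"
    by (rule integral_norm_bound)
  also have "\<dots> \<le> (\<integral>z. L * norm v * bump \<delta> p z \<partial>lebesgue_on \<Omega>)"
  proof (rule integral_mono_AE)
    show "integrable (lebesgue_on \<Omega>) (\<lambda>z. norm ((G z \<bullet> v) * bump \<delta> p z))"
      using weak_grad_bump(1)[OF assms(1-4)] by (rule integrable_norm)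
    show "integrable (lebesgue_on \<Omega>) (\<lambda>z. L * norm v * bump \<delta> p z)"
      using bump(1) by simp
    show "AE z in lebesgue_on \<Omega>. norm ((G z \<bullet> v) * bump \<delta> p z) \<le> L * norm v * bump \<delta> p z"
      using assms(5)
    proof eventually_elim
      case (elim z)
      have "\<bar>G z \<bullet> v\<bar> \<le> norm (G z) * norm v" by (rule Cauchy_Schwarz_ineq2)
      also have "\<dots> \<le> L * norm v" using elim by (rule mult_right_mono) simp
      finally show ?case by (simp add: abs_mult bump_nonneg mult_right_mono)
    qed
  qed
  also have "\<dots> = L * norm v * bump_mass TYPE('a) \<delta>"
    using bump by simp
  finally show ?thesis .
qed

text \<open>Along the segment the mollifications of \<open>u\<close> are differentiable with derivative at most
  \<open>L * dist p q\<close>, by the previous lemma; by continuity they are close to \<open>u\<close> at the two end points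
  when the mollification radius is small. The mollifications are not normalised: all estimates carry
  the mass \<open>c\<close> of the bump, which is cancelled at the end.

  The radius is chosen so that all bumps met along the segment live in a compact subset \<open>K\<close> of the
  domain. A continuous extension \<open>w\<close> of the restriction of \<open>u\<close> to \<open>K\<close> makes the integrands continuous on a box
  around \<open>K\<close>, as differentiation under the integral sign demands.\<close>

lemma weak_grad_bound_imp_lipschitz:
  fixes \<Omega> :: "'a::euclidean_space set" and u :: "'a \<Rightarrow> real"
  assumes weak: "has_weak_grad \<Omega> u G" and L: "AE x in lebesgue_on \<Omega>. norm (G x) \<le> L"
    and \<Omega>: "open \<Omega>" and u: "continuous_on \<Omega> u" and seg: "closed_segment p q \<subseteq> \<Omega>"
  shows "\<bar>u q - u p\<bar> \<le> L * dist p q"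
proof (rule field_le_epsilon)
  fix \<epsilon> :: real assume "\<epsilon> > 0"
  define e where "e = \<epsilon> / 2"
  have e: "e > 0" using \<open>\<epsilon> > 0\<close> by (simp add: e_def)
  obtain d where d: "d > 0" "(\<Union>x\<in>closed_segment p q. cball x d) \<subseteq> \<Omega>"
    using compact_subset_open_imp_cball_epsilon_subset[OF compact_segment \<Omega> seg] by blast
  define K where "K = (\<Union>x\<in>closed_segment p q. cball x d)"
  have K: "compact K" "K \<subseteq> \<Omega>"
    using d compact_minkowski_sum_cball[OF compact_segment] by (auto simp: K_def)
  obtain w where w: "continuous_on UNIV w" "\<And>x. x \<in> K \<Longrightarrow> w x = u x"
    using Tietze_unbounded[of K u UNIV] continuous_on_subset[OF u K(2)] compact_imp_closed[OF K(1)]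
    by auto
  obtain a where a: "K \<subseteq> cbox (- a) a"
    using bounded_subset_cbox_symmetric[OF compact_imp_bounded[OF K(1)]] by blast
  have close: "\<exists>\<delta>>0. \<forall>z. dist z x \<le> \<delta> \<longrightarrow> \<bar>w z - w x\<bar> \<le> e" for x
  proof -
    have "isCont w x" using w(1) by (simp add: continuous_on_eq_continuous_at)
    then obtain \<delta> where "\<delta> > 0" "\<forall>z. dist z x < \<delta> \<longrightarrow> dist (w z) (w x) < e"
      using e unfolding continuous_at_eps_delta by blast
    then have "\<bar>w z - w x\<bar> \<le> e" if "dist z x \<le> \<delta> / 2" for z
      using that by (smt (verit) dist_real_def field_sum_of_halves)
    then show ?thesis using \<open>\<delta> > 0\<close> half_gt_zero by blast
  qed
  obtain \<delta>p \<delta>q where \<delta>pq: "\<delta>p > 0" "\<And>z. dist z p \<le> \<delta>p \<Longrightarrow> \<bar>w z - w p\<bar> \<le> e"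
     "\<delta>q > 0" "\<And>z. dist z q \<le> \<delta>q \<Longrightarrow> \<bar>w z - w q\<bar> \<le> e"
    using close[of p] close[of q] by metis
  define \<delta> where "\<delta> = min d (min \<delta>p \<delta>q)"
  have \<delta>: "\<delta> > 0" "\<delta> \<le> d" "\<delta> \<le> \<delta>p" "\<delta> \<le> \<delta>q" using d \<delta>pq by (auto simp: \<delta>_def)
  define c where "c = bump_mass TYPE('a) \<delta>"
  have c: "c > 0" unfolding c_def by (rule bump_mass_pos[OF \<delta>(1)])
  define v where "v = q - p"
  have in_seg: "p + t *\<^sub>R v \<in> closed_segment p q" if "t \<in> {0..1}" for t
    using that by (auto simp: in_segment v_def algebra_simps intro!: exI[of _ t])
  have ball: "cball (p + t *\<^sub>R v) \<delta> \<subseteq> K" if "t \<in> {0..1}" for t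
    using in_seg[OF that] \<delta>(2) by (auto simp: K_def)
  have supp: "bump_deriv \<delta> (p + t *\<^sub>R v) z v = 0" if "t \<in> {0..1}" "z \<notin> K" for t z
    using ball[OF that(1)] that(2) \<delta>(1) by (intro bump_deriv_eq_0) (auto simp: subset_eq not_le[symmetric])
  \<comment> \<open>\<open>F t\<close> is the mollification at \<open>p + t *\<^sub>R v\<close>, and \<open>F' t\<close> its derivative in \<open>t\<close>\<close>
  define F where "F t = integral (cbox (- a) a) (\<lambda>z. w z * bump \<delta> (p + t *\<^sub>R v) z)" for t
  define F' where "F' t = integral (cbox (- a) a) (\<lambda>z. w z * - bump_deriv \<delta> (p + t *\<^sub>R v) z v)" for t
  have "norm (F 1 - F 0) \<le> (L * norm v * c) * norm (1 - 0 :: real)"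
  proof (rule field_differentiable_bound[where f = F and f' = F' and S = "{0..1}"])
    fix t :: real assume t: "t \<in> {0..1}"
    show "(F has_field_derivative F' t) (at t within {0..1})"
      unfolding F_def F'_def
    proof (rule leibniz_rule_field_derivative[where f = "\<lambda>t z. w z * bump \<delta> (p + t *\<^sub>R v) z"])
      show "continuous_on ({0..1} \<times> cbox (- a) a) (\<lambda>(t, z). w z * - bump_deriv \<delta> (p + t *\<^sub>R v) z v)"
        unfolding bump_deriv_def case_prod_unfold
        by (intro continuous_intros continuous_on_compose2[OF continuous_flat_exp]
              continuous_on_compose2[OF w(1)]) auto
      show "(\<lambda>z. w z * bump \<delta> (p + t *\<^sub>R v) z) integrable_on cbox (- a) a" for t
        by (intro integrable_continuous continuous_intros continuous_on_subset[OF w(1)]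
              continuous_on_subset[OF continuous_on_bump]) auto
      show "((\<lambda>t. w z * bump \<delta> (p + t *\<^sub>R v) z) has_field_derivative
           w z * - bump_deriv \<delta> (p + t *\<^sub>R v) z v) (at t within {0..1})" for t z
        using has_vector_derivative_bump_path[of \<delta> p v z t "{0..1}"]
        by (intro DERIV_cmult) (simp add: has_real_derivative_iff_has_vector_derivative)
    qed (use t in auto)
    have "integral\<^sup>L (lebesgue_on \<Omega>) (\<lambda>z. u z * bump_deriv \<delta> (p + t *\<^sub>R v) z v)
        = integral (cbox (- a) a) (\<lambda>z. u z * bump_deriv \<delta> (p + t *\<^sub>R v) z v)"
    proof (rule integral_compact_support(2))
      obtain b :: 'a where "b \<in> Basis" using nonempty_Basis by blast
      then have "u absolutely_integrable_on K"
        using weak K by (auto simp: has_weak_grad_def has_weak_partial_def locally_integrable_def)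
      then show "(\<lambda>z. u z * bump_deriv \<delta> (p + t *\<^sub>R v) z v) absolutely_integrable_on K"
        using K by (intro absolutely_integrable_mult_continuous continuous_on_subset[OF continuous_on_bump_deriv]) auto
    qed (use K a \<Omega> supp[OF t] in \<open>auto intro: fmeasurableD lmeasurable_compact\<close>)
    also have "\<dots> = - F' t"
      unfolding F'_def integral_neg[symmetric] using w(2) supp[OF t]
      by (intro integral_cong) (metis minus_minus mult_minus_right mult_zero_right)
    finally have "\<bar>F' t\<bar> = \<bar>\<integral>z. u z * bump_deriv \<delta> (p + t *\<^sub>R v) z v \<partial>lebesgue_on \<Omega>\<bar>" by simp
    also have "\<dots> \<le> L * norm v * c"
      unfolding c_def using weak_grad_bump_bound[OF weak \<Omega> _ _ L] ball[OF t] K(2) \<delta>(1) by auto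
    finally show "norm (F' t) \<le> L * norm v * c" by simp
  qed auto
  then have FF: "\<bar>F 1 - F 0\<bar> \<le> L * norm v * c" by simp
  have avg: "\<bar>F t - w (p + t *\<^sub>R v) * c\<bar> \<le> e * c"
    if t: "t \<in> {0..1}" and near: "\<And>z. dist z (p + t *\<^sub>R v) \<le> \<delta> \<Longrightarrow> \<bar>w z - w (p + t *\<^sub>R v)\<bar> \<le> e" for t
  proof -
    define x where "x = p + t *\<^sub>R v"
    have b: "(bump \<delta> x has_integral c) (cbox (- a) a)"
      unfolding c_def x_def using ball[OF t] a \<delta>(1) by (intro has_integral_bump) auto
    have i: "(\<lambda>z. w z * bump \<delta> x z) integrable_on cbox (- a) a"
      by (intro integrable_continuous continuous_intros continuous_on_subset[OF w(1)]
              continuous_on_subset[OF continuous_on_bump]) auto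
    have "((\<lambda>z. w z * bump \<delta> x z - w x * bump \<delta> x z) has_integral F t - w x * c) (cbox (- a) a)"
      unfolding F_def x_def[symmetric] using i b
      by (intro has_integral_diff has_integral_mult_right integrable_integral)
    then have d: "((\<lambda>z. (w z - w x) * bump \<delta> x z) has_integral F t - w x * c) (cbox (- a) a)"
      by (simp add: algebra_simps)
    have "norm (F t - w x * c) \<le> integral (cbox (- a) a) (\<lambda>z. e * bump \<delta> x z)"
      unfolding integral_unique[OF d, symmetric]
    proof (rule integral_norm_bound_integral)
      show "(\<lambda>z. (w z - w x) * bump \<delta> x z) integrable_on cbox (- a) a"
        using d by (rule has_integral_integrable)
      show "(\<lambda>z. e * bump \<delta> x z) integrable_on cbox (- a) a"
        using has_integral_mult_right[OF b] by (rule has_integral_integrable)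
      fix z
      show "norm ((w z - w x) * bump \<delta> x z) \<le> e * bump \<delta> x z"
      proof (cases "dist z x \<le> \<delta>")
        case True
        then show ?thesis
          using near[of z] by (simp add: abs_mult bump_nonneg mult_right_mono x_def)
      qed (use \<delta>(1) in \<open>simp add: bump_eq_0 dist_commute\<close>)
    qed
    also have "\<dots> = e * c" using b by (simp add: integral_unique)
    finally show ?thesis by (simp add: x_def)
  qed
  have "\<bar>F 0 - w p * c\<bar> \<le> e * c" using avg[of 0] \<delta>pq(2) \<delta> by fastforce
  moreover have "\<bar>F 1 - w q * c\<bar> \<le> e * c" using avg[of 1] \<delta>pq(4) \<delta> by (fastforce simp: v_def)
  ultimately have "\<bar>w q * c - w p * c\<bar> \<le> L * norm v * c + 2 * (e * c)"
    using FF by linarith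
  moreover have "\<bar>w q * c - w p * c\<bar> = \<bar>w q - w p\<bar> * c"
    using c by (simp add: abs_mult flip: left_diff_distrib)
  ultimately have "\<bar>w q - w p\<bar> * c \<le> (L * norm v + 2 * e) * c"
    by (simp add: algebra_simps)
  then have "\<bar>w q - w p\<bar> \<le> L * norm v + 2 * e" using c by simp
  moreover have "p \<in> K" "q \<in> K" using d(1) by (force simp: K_def)+
  ultimately show "\<bar>u q - u p\<bar> \<le> L * dist p q + \<epsilon>"
    using w(2) by (simp add: v_def e_def dist_norm norm_minus_commute)
qed

section \<open>The primitive of a Caratheodory function\<close>

lemma primitive_0 [simp]: "primitive h x 0 = 0"
  by (simp add: primitive_def)

lemma primitive_has_real_derivative:
  assumes "continuous_on UNIV (h x)"
  shows "(primitive h x has_real_derivative h x s) (at s)"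
proof -
  define c where "c = \<bar>s\<bar> + 1"
  have eq: "primitive h x = (\<lambda>u. LBINT y=ereal 0..ereal u. h x y)"
    by (rule ext) (rule primitive_def)
  have c: "- c \<le> 0" "0 \<le> c" "- c < s" "s < c" unfolding c_def by linarith+
  have "(primitive h x has_vector_derivative h x s) (at s within {-c..c})"
    unfolding eq using c by (intro interval_integral_FTC2 continuous_on_subset[OF assms]) auto
  moreover have "at s within {-c..c} = at s"
    using c by (intro at_within_interior) simp
  ultimately show ?thesis
    by (simp only: has_real_derivative_iff_has_vector_derivative)
qed

lemma primitive_mono_away_from_0:
  assumes cont: "continuous_on UNIV (h x)" and sign: "\<And>s. s \<noteq> 0 \<Longrightarrow> h x s * s > 0"
    and "(0 \<le> a \<and> a \<le> b) \<or> (b \<le> a \<and> a \<le> 0)"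
  shows "primitive h x a \<le> primitive h x b"
proof -
  note D = primitive_has_real_derivative[of h x, OF cont]
  have C: "continuous_on S (primitive h x)" for S
    using D by (meson DERIV_isCont continuous_at_imp_continuous_on)
  have h0: "h x s \<ge> 0" if "s > 0" for s using sign[of s] that by (simp add: zero_less_mult_iff)
  have h0': "h x s \<le> 0" if "s < 0" for s using sign[of s] that by (simp add: zero_less_mult_iff)
  show ?thesis using assms(3)
  proof
    assume "0 \<le> a \<and> a \<le> b"
    then show ?thesis
      using DERIV_nonneg_imp_increasing_open[of a b "primitive h x"] C D h0 by force
  next
    assume "b \<le> a \<and> a \<le> 0"
    then show ?thesis
      using DERIV_nonpos_imp_decreasing_open[of b a "primitive h x"] C D h0' by force
  qed
qed

lemma primitive_pos:
  assumes cont: "continuous_on UNIV (h x)" and sign: "\<And>s. s \<noteq> 0 \<Longrightarrow> h x s * s > 0"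
    and "s \<noteq> 0"
  shows "primitive h x s > 0"
proof -
  note D = primitive_has_real_derivative[of h x, OF cont]
  have C: "continuous_on S (primitive h x)" for S
    using D by (meson DERIV_isCont continuous_at_imp_continuous_on)
  have h0: "h x s > 0" if "s > 0" for s using sign[of s] that by (simp add: zero_less_mult_iff)
  have h0': "h x s < 0" if "s < 0" for s using sign[of s] that by (simp add: zero_less_mult_iff)
  consider "s > 0" | "s < 0" using \<open>s \<noteq> 0\<close> by linarith
  then show ?thesis
  proof cases
    case 1
    then have "primitive h x 0 < primitive h x s"
      using DERIV_pos_imp_increasing_open[OF 1, of "primitive h x"] C D h0 by force
    then show ?thesis by simp
  next
    case 2
    then have "primitive h x 0 < primitive h x s"
      using DERIV_neg_imp_decreasing_open[OF 2, of "primitive h x"] C D h0' by force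
    then show ?thesis by simp
  qed
qed

lemma primitive_bound:
  assumes cont: "continuous_on UNIV (h x)" and bound: "\<And>s. \<bar>s\<bar> \<le> \<rho> \<Longrightarrow> \<bar>h x s\<bar> \<le> A"
    and "\<bar>s\<bar> \<le> \<rho>"
  shows "\<bar>primitive h x s\<bar> \<le> A * \<rho>"
proof -
  have A: "A \<ge> 0" using bound[of 0] assms(3) by force
  have "norm (primitive h x s - primitive h x 0) \<le> A * norm (s - 0)"
  proof (rule field_differentiable_bound[of "{-\<rho>..\<rho>}" _ "h x"])
    show "(primitive h x has_field_derivative h x z) (at z within {-\<rho>..\<rho>})" for z
      by (rule has_field_derivative_at_within[OF primitive_has_real_derivative[of h x, OF cont]])
    show "norm (h x z) \<le> A" if "z \<in> {-\<rho>..\<rho>}" for z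
      using that bound[of z] by (simp add: abs_le_iff)
  qed (use assms(3) in \<open>simp_all add: abs_le_iff\<close>)
  also have "\<dots> \<le> A * \<rho>" using A assms(3) by (simp add: mult_left_mono)
  finally show ?thesis by (simp only: primitive_0 diff_0_right real_norm_def)
qed

text \<open>A Caratheodory function is jointly measurable: rounding the second argument down to a multiple
  of \<open>1 / (n + 1)\<close> leaves countably many values for it, hence a jointly measurable function, and
  continuity gives pointwise convergence as \<open>n\<close> grows.\<close>

lemma continuous_in_second_measurable_pair:
  fixes h :: "'a \<Rightarrow> real \<Rightarrow> real"
  assumes meas: "\<And>s. (\<lambda>x. h x s) \<in> borel_measurable M"
    and cont: "\<And>x. x \<in> space M \<Longrightarrow> continuous_on UNIV (h x)"
  shows "(\<lambda>(x, s). h x s) \<in> borel_measurable (M \<Otimes>\<^sub>M borel)"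
proof -
  define r where "r n s = of_int \<lfloor>real (Suc n) * s\<rfloor> / real (Suc n)" for n and s :: real
  have m: "(\<lambda>(x, s). h x (r n s)) \<in> borel_measurable (M \<Otimes>\<^sub>M borel)" for n
  proof -
    have "(\<lambda>p. (\<lambda>k p. h (fst p) (of_int k / real (Suc n))) (\<lfloor>real (Suc n) * snd p\<rfloor>) p)
        \<in> borel_measurable (M \<Otimes>\<^sub>M borel)"
    proof (rule measurable_compose_countable[where f = "\<lambda>k p. h (fst p) (of_int k / real (Suc n))"
          and g = "\<lambda>p. \<lfloor>real (Suc n) * snd p\<rfloor>"])
      show "(\<lambda>p. h (fst p) (real_of_int k / real (Suc n))) \<in> borel_measurable (M \<Otimes>\<^sub>M borel)" for k
        by (rule measurable_compose[OF measurable_fst meas])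
      show "(\<lambda>p. \<lfloor>real (Suc n) * snd p\<rfloor>) \<in> M \<Otimes>\<^sub>M borel \<rightarrow>\<^sub>M count_space UNIV"
        by measurable
    qed
    then show ?thesis by (simp add: r_def case_prod_unfold)
  qed
  have l: "(\<lambda>n. (\<lambda>(x, s). h x (r n s)) p) \<longlonglongrightarrow> (\<lambda>(x, s). h x s) p"
    if ps: "p \<in> space (M \<Otimes>\<^sub>M borel)" for p
  proof -
    obtain x s where p: "p = (x, s)" "x \<in> space M"
      using ps by (auto simp: space_pair_measure)
    have "(\<lambda>n. r n s) \<longlonglongrightarrow> s"
    proof (rule tendsto_sandwich)
      show "(\<lambda>n. s - 1 / real (Suc n)) \<longlonglongrightarrow> s"
        using tendsto_diff[OF tendsto_const LIMSEQ_inverse_real_of_nat, of s] by (simp add: inverse_eq_divide)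
      show "\<forall>\<^sub>F n in sequentially. s - 1 / real (Suc n) \<le> r n s"
      proof (rule always_eventually, rule allI)
        fix n
        have "real (Suc n) * s - 1 \<le> of_int \<lfloor>real (Suc n) * s\<rfloor>" by linarith
        then have "(real (Suc n) * s - 1) / real (Suc n) \<le> r n s"
          unfolding r_def by (rule divide_right_mono) simp
        then show "s - 1 / real (Suc n) \<le> r n s" by (simp add: diff_divide_distrib)
      qed
      show "\<forall>\<^sub>F n in sequentially. r n s \<le> s"
      proof (rule always_eventually, rule allI)
        fix n
        have "of_int \<lfloor>real (Suc n) * s\<rfloor> \<le> real (Suc n) * s" by linarith
        then have "r n s \<le> (real (Suc n) * s) / real (Suc n)"
          unfolding r_def by (rule divide_right_mono) simp
        then show "r n s \<le> s" by simp
      qed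
    qed (rule tendsto_const)
    then have "(\<lambda>n. h x (r n s)) \<longlonglongrightarrow> h x s"
      using cont[OF p(2)] continuous_on_tendsto_compose[of UNIV "h x" "\<lambda>n. r n s" s] by simp
    then show ?thesis by (simp add: p)
  qed
  show ?thesis by (rule borel_measurable_LIMSEQ_real[OF l m])
qed

text \<open>The upper limit of integration may depend on \<open>x\<close>: the integrand, cut off between \<open>0\<close> and
  \<open>w x\<close>, is jointly measurable, and integrating out one variable keeps measurability in the other.\<close>

lemma primitive_measurable:
  fixes h :: "'a \<Rightarrow> real \<Rightarrow> real"
  assumes meas: "\<And>s. (\<lambda>x. h x s) \<in> borel_measurable M"
    and cont: "\<And>x. x \<in> space M \<Longrightarrow> continuous_on UNIV (h x)"
    and w[measurable]: "w \<in> borel_measurable M"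
  shows "(\<lambda>x. primitive h x (w x)) \<in> borel_measurable M"
proof -
  note continuous_in_second_measurable_pair[of h M, OF meas cont]
  then have [measurable]: "(\<lambda>(x, s). h x s) \<in> borel_measurable (M \<Otimes>\<^sub>M lborel)"
    by (simp cong: measurable_cong_sets)
  have "(\<lambda>x. if 0 \<le> w x then LINT \<tau>|lborel. indicator {0<..<w x} \<tau> *\<^sub>R h x \<tau>
      else - (LINT \<tau>|lborel. indicator {w x<..<0} \<tau> *\<^sub>R h x \<tau>)) \<in> borel_measurable M"
    unfolding indicator_def greaterThanLessThan_iff by measurable
  then show ?thesis
    unfolding primitive_def interval_lebesgue_integral_def set_lebesgue_integral_def einterval_eq
    by simp
qed

lemma Linf_AE_bound:
  assumes "Linf \<Omega> \<alpha>"
  shows "\<exists>A. AE x in lebesgue_on \<Omega>. norm (\<alpha> x) \<le> A"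
proof -
  have ae: "AE x in lebesgue_on \<Omega>. ereal (norm (\<alpha> x)) \<le> Linf_norm \<Omega> \<alpha>"
    unfolding Linf_norm_def by (rule esssup_AE)
  have "Linf_norm \<Omega> \<alpha> < \<infinity>" using assms by (simp add: Linf_def)
  then obtain A where A: "Linf_norm \<Omega> \<alpha> \<le> ereal A"
    by (cases "Linf_norm \<Omega> \<alpha>") auto
  then have "AE x in lebesgue_on \<Omega>. norm (\<alpha> x) \<le> A"
    by (intro eventually_mono[OF ae]) (metis A ereal_less_eq(3) order_trans)
  then show ?thesis ..
qed

text \<open>Both the continuity of \<open>h x\<close> and its bound hold for almost every \<open>x\<close> only, so \<open>h\<close> is replaced by
  \<open>0\<close> on the exceptional null set. The modified integrand is measurable and bounded, and a null set
  does not affect integrability.\<close>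

lemma primitive_integrable:
  fixes \<Omega> :: "'a::euclidean_space set"
  assumes \<Omega>: "open \<Omega>" "bounded \<Omega>" and h1: "hyp_h1 \<Omega> h"
    and w: "w \<in> borel_measurable (lebesgue_on \<Omega>)" and bound: "\<And>x. x \<in> \<Omega> \<Longrightarrow> \<bar>w x\<bar> \<le> \<rho>"
  shows "integrable (lebesgue_on \<Omega>) (\<lambda>x. primitive h x (w x))"
proof -
  have \<Omega>s: "\<Omega> \<in> sets lebesgue" "emeasure lebesgue \<Omega> < \<infinity>"
    using \<Omega> emeasure_bounded_finite[of \<Omega>] by (auto simp: top.not_eq_extremum)
  have meas: "\<And>s. (\<lambda>x. h x s) \<in> borel_measurable (lebesgue_on \<Omega>)"
    and cont: "AE x in lebesgue_on \<Omega>. continuous_on UNIV (h x)"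
    using h1 by (auto simp: hyp_h1_def caratheodory_def)
  \<comment> \<open>the growth condition speaks of positive bounds only, and \<open>\<rho>\<close> may be \<open>0\<close>\<close>
  have "0 < max 1 \<rho>" by simp
  then have "\<exists>\<alpha> :: 'a \<Rightarrow> real. Linf \<Omega> \<alpha> \<and>
      (AE x in lebesgue_on \<Omega>. \<forall>s. \<bar>s\<bar> \<le> max 1 \<rho> \<longrightarrow> \<bar>h x s\<bar> \<le> \<alpha> x)"
    using h1 unfolding hyp_h1_def by blast
  then obtain \<alpha> :: "'a \<Rightarrow> real" where \<alpha>: "Linf \<Omega> \<alpha>"
     "AE x in lebesgue_on \<Omega>. \<forall>s. \<bar>s\<bar> \<le> max 1 \<rho> \<longrightarrow> \<bar>h x s\<bar> \<le> \<alpha> x"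
    by (elim exE conjE)
  obtain A where A: "AE x in lebesgue_on \<Omega>. norm (\<alpha> x) \<le> A"
    using Linf_AE_bound[OF \<alpha>(1)] by blast
  have good: "AE x in lebesgue_on \<Omega>. continuous_on UNIV (h x) \<and> (\<forall>s. \<bar>s\<bar> \<le> max 1 \<rho> \<longrightarrow> \<bar>h x s\<bar> \<le> A)"
    using cont \<alpha>(2) A by eventually_elim (force simp: abs_le_iff)
  then obtain N where N: "N \<in> null_sets (lebesgue_on \<Omega>)"
    "\<And>x. x \<in> \<Omega> - N \<Longrightarrow> continuous_on UNIV (h x) \<and> (\<forall>s. \<bar>s\<bar> \<le> max 1 \<rho> \<longrightarrow> \<bar>h x s\<bar> \<le> A)"
    by (auto simp: eventually_ae_filter)
  define h' where "h' x s = (if x \<in> N then 0 else h x s)" for x s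
  have Nm[measurable]: "N \<in> sets (lebesgue_on \<Omega>)" using N(1) by auto
  have m': "(\<lambda>x. h' x s) \<in> borel_measurable (lebesgue_on \<Omega>)" for s
    unfolding h'_def using meas[of s] by measurable
  have c': "continuous_on UNIV (h' x)" if "x \<in> space (lebesgue_on \<Omega>)" for x
    using N(2)[of x] that by (cases "x \<in> N") (auto simp: h'_def[abs_def])
  have A0: "\<bar>A\<bar> \<ge> A" by simp
  have b': "\<bar>primitive h' x (w x)\<bar> \<le> \<bar>A\<bar> * max 1 \<rho>" if "x \<in> \<Omega>" for x
    using that c' N(2)[of x] bound[OF that]
    by (intro primitive_bound) (auto simp: h'_def intro: order_trans[OF _ A0])
  have "integrable (lebesgue_on \<Omega>) (\<lambda>x. primitive h' x (w x))"
  proof (rule Bochner_Integration.integrable_bound[of _ "\<lambda>x. \<bar>A\<bar> * max 1 \<rho>"])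
    show "integrable (lebesgue_on \<Omega>) (\<lambda>x. \<bar>A\<bar> * max 1 \<rho>)"
      using \<Omega>s by (intro finite_measure.integrable_const finite_measure_lebesgue_on) (auto intro: fmeasurableI)
    show "(\<lambda>x. primitive h' x (w x)) \<in> borel_measurable (lebesgue_on \<Omega>)"
      by (rule primitive_measurable[OF m' c' w])
  qed (use b' in auto)
  then have "(\<lambda>x. primitive h' x (w x)) absolutely_integrable_on \<Omega>"
    using \<Omega>s by (simp add: set_integrable_def integrable_restrict_space)
  moreover have "negligible N"
    using N(1) \<Omega>s by (auto simp: null_sets_restrict_space negligible_iff_null_sets)
  moreover have "primitive h x (w x) = primitive h' x (w x)" if "x \<in> \<Omega> - N" for x
    using that by (simp add: primitive_def h'_def)
  ultimately have "(\<lambda>x. primitive h x (w x)) absolutely_integrable_on \<Omega>"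
    by (rule absolutely_integrable_spike)
  then show ?thesis using \<Omega>s by (intro absolutely_integrable_imp_integrable)
qed

section \<open>Integrals of a positive function over balls\<close>

text \<open>Each single integral is positive, because a ball around a point of the closure meets
  the open set in a set of positive measure. Uniformity comes from compactness: finitely many balls
  of radius \<open>r / 2\<close> cover the closure, and the ball of radius \<open>r\<close> around \<open>x\<close> contains the one of
  them in which \<open>x\<close> lies.\<close>

lemma integral_over_balls_bounded_below:
  fixes \<Omega> :: "'a::euclidean_space set" and \<eta> :: "'a \<Rightarrow> real"
  assumes \<Omega>: "open \<Omega>" "bounded \<Omega>" and int: "integrable (lebesgue_on \<Omega>) \<eta>"
    and pos: "AE x in lebesgue_on \<Omega>. \<eta> x > 0" and r: "r > 0"
  shows "\<exists>\<kappa>>0. \<forall>x\<in>\<Omega>. (\<integral>y. indicator (ball x r) y * \<eta> y \<partial>lebesgue_on \<Omega>) \<ge> \<kappa>"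
proof -
  define J where "J x s = (\<integral>y. indicator (ball x s) y * \<eta> y \<partial>lebesgue_on \<Omega>)" for x s
  have \<Omega>s: "\<Omega> \<in> sets lebesgue" using \<Omega> by auto
  have i: "integrable (lebesgue_on \<Omega>) (\<lambda>y. indicator (ball x s) y * \<eta> y)" for x s
  proof -
    have "ball x s \<inter> \<Omega> \<in> sets (lebesgue_on \<Omega>)"
      using \<Omega>s sets.Int[OF fmeasurableD[OF lmeasurable_ball] \<Omega>s, of x s]
      by (subst sets_restrict_space_iff) simp_all
    from integrable_mult_indicator[OF this int]
    have "integrable (lebesgue_on \<Omega>) (\<lambda>y. indicator (ball x s \<inter> \<Omega>) y *\<^sub>R \<eta> y)" .
    moreover have "integrable (lebesgue_on \<Omega>) (\<lambda>y. indicator (ball x s \<inter> \<Omega>) y *\<^sub>R \<eta> y)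
        \<longleftrightarrow> integrable (lebesgue_on \<Omega>) (\<lambda>y. indicator (ball x s) y * \<eta> y)"
      by (rule Bochner_Integration.integrable_cong) (simp_all add: indicator_def)
    ultimately show ?thesis by blast
  qed
  have Jpos: "J x s > 0" if xs: "x \<in> closure \<Omega>" "s > 0" for x s
  proof -
    have "J x s \<ge> 0"
      unfolding J_def using pos by (intro integral_nonneg_AE) (auto elim!: eventually_mono simp: indicator_def)
    moreover have "J x s \<noteq> 0"
    proof
      assume "J x s = 0"
      then have "AE y in lebesgue_on \<Omega>. indicator (ball x s) y * \<eta> y = 0"
        unfolding J_def
        by (subst (asm) integral_nonneg_eq_0_iff_AE[OF i])
           (use pos in \<open>auto elim!: eventually_mono simp: indicator_def\<close>)
      then have "AE y in lebesgue_on \<Omega>. y \<notin> ball x s"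
        using pos by eventually_elim (auto simp: indicator_def split: if_splits)
      then have "AE y in lebesgue. y \<notin> ball x s \<inter> \<Omega>"
        using \<Omega>s by (subst (asm) AE_restrict_space_iff) (auto elim!: eventually_mono)
      then have "ball x s \<inter> \<Omega> \<in> null_sets lebesgue"
        using \<Omega>s by (subst AE_iff_null_sets) auto
      then have "negligible (ball x s \<inter> \<Omega>)" by (simp add: negligible_iff_null_sets)
      moreover obtain y where "y \<in> \<Omega>" "dist y x < s"
        using xs closure_approachable[of x \<Omega>] by auto
      then have "y \<in> ball x s \<inter> \<Omega>" by (simp add: dist_commute)
      ultimately show False
        using open_not_negligible[of "ball x s \<inter> \<Omega>"] \<Omega>(1) by blast
    qed
    ultimately show ?thesis by simp
  qed
  have "closure \<Omega> \<subseteq> (\<Union>p\<in>closure \<Omega>. ball p (r/2))"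
    using r by (intro subsetI UN_I) auto
  then obtain F where F: "F \<subseteq> closure \<Omega>" "finite F" "closure \<Omega> \<subseteq> (\<Union>p\<in>F. ball p (r/2))"
    by (rule compactE_image[OF _ _, of "closure \<Omega>" "closure \<Omega>", rotated 2])
       (use \<Omega> in \<open>auto simp: compact_closure\<close>)
  define \<kappa> where "\<kappa> = Min (insert 1 ((\<lambda>p. J p (r/2)) ` F))"
  have \<kappa>: "\<kappa> \<in> insert 1 ((\<lambda>p. J p (r/2)) ` F)"
    unfolding \<kappa>_def by (rule Min_in) (simp_all add: F(2))
  have "J p (r/2) > 0" if p: "p \<in> F" for p
  proof (rule Jpos)
    show "p \<in> closure \<Omega>" using p F(1) by blast
  qed (use r in simp)
  with \<kappa> have "\<kappa> > 0" by (elim insertE imageE) simp_all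
  have "\<kappa> \<le> J x r" if "x \<in> \<Omega>" for x
  proof -
    from subsetD[OF F(3) subsetD[OF closure_subset that]]
    obtain p where p: "p \<in> F" "x \<in> ball p (r/2)" by (rule UN_E)
    have sub: "ball p (r/2) \<subseteq> ball x r"
    proof
      fix y assume "y \<in> ball p (r/2)"
      then show "y \<in> ball x r"
        using p(2) dist_triangle[of x y p] by (simp add: dist_commute)
    qed
    have "\<kappa> \<le> J p (r/2)" unfolding \<kappa>_def using F(2) p(1) by (intro Min_le) auto
    also have "\<dots> \<le> J x r"
      unfolding J_def using pos sub
      by (intro integral_mono_AE i) (auto elim!: eventually_mono simp: indicator_def)
    finally show ?thesis .
  qed
  with \<open>\<kappa> > 0\<close> show ?thesis unfolding J_def by blast
qed

section \<open>Regularity and boundary behaviour of solutions\<close>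

text \<open>The estimate \<open>lip\<close> is available only along
  segments inside the domain, so it is used on the half-open segment from \<open>x\<close> to a nearest boundary
  point \<open>z\<close>, which lies in the largest ball around \<open>x\<close> inside the domain; continuity up to the
  boundary and \<open>u z = 0\<close> then bound \<open>\<bar>u x\<bar>\<close> by the radius of that ball.\<close>

lemma ball_abs_value_subset:
  fixes \<Omega> :: "'a::euclidean_space set" and u :: "'a \<Rightarrow> real"
  assumes \<Omega>: "open \<Omega>" "bounded \<Omega>" and u: "continuous_on (closure \<Omega>) u"
    and zero: "\<And>x. x \<in> frontier \<Omega> \<Longrightarrow> u x = 0"
    and lip: "\<And>p q. closed_segment p q \<subseteq> \<Omega> \<Longrightarrow> \<bar>u q - u p\<bar> \<le> dist p q"
    and x: "x \<in> \<Omega>"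
  shows "ball x \<bar>u x\<bar> \<subseteq> \<Omega>"
proof -
  have "frontier \<Omega> \<noteq> {}"
    using \<Omega>(2) x by (intro frontier_not_empty) auto
  then obtain z where z: "z \<in> frontier \<Omega>" "\<And>y. y \<in> frontier \<Omega> \<Longrightarrow> dist x z \<le> dist x y"
    using distance_attains_inf[OF frontier_closed] by metis
  define d where "d = dist x z"
  have "z \<noteq> x" using z(1) x \<Omega>(1) by (auto simp: frontier_def interior_open)
  then have d: "d > 0" by (simp add: d_def)
  have sub: "ball x d \<subseteq> \<Omega>"
  proof (rule ccontr)
    assume "\<not> ball x d \<subseteq> \<Omega>"
    then have "ball x d \<inter> frontier \<Omega> \<noteq> {}"
      using x d centre_in_ball[of x d] by (intro connected_Int_frontier) blast+
    then obtain y where y: "y \<in> ball x d" "y \<in> frontier \<Omega>" by blast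
    then show False using z(2)[OF y(2)] by (simp add: d_def)
  qed
  define y where "y n = z + (1 / real (Suc n)) *\<^sub>R (x - z)" for n
  have yx: "y n - x = (1 - 1 / real (Suc n)) *\<^sub>R (z - x)" for n
    by (simp add: y_def algebra_simps)
  have dy: "dist x (y n) < d" for n
  proof -
    have "dist x (y n) = (1 - 1 / real (Suc n)) * d"
      by (simp add: dist_norm norm_minus_commute[of x] yx d_def)
    also have "\<dots> < 1 * d" using d by (intro mult_strict_right_mono) simp_all
    finally show ?thesis by simp
  qed
  have bound: "\<bar>u (y n) - u x\<bar> \<le> d" for n
  proof -
    have "closed_segment x (y n) \<subseteq> ball x d"
      using dy d by (intro closed_segment_subset) simp_all
    then have "\<bar>u (y n) - u x\<bar> \<le> dist x (y n)" using sub by (intro lip) (rule order_trans)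
    then show ?thesis using dy[of n] by linarith
  qed
  have "(\<lambda>n. z + (1 / real (Suc n)) *\<^sub>R (x - z)) \<longlonglongrightarrow> z + 0 *\<^sub>R (x - z)"
    using LIMSEQ_inverse_real_of_nat unfolding inverse_eq_divide
    by (intro tendsto_add tendsto_scaleR tendsto_const)
  then have "y \<longlonglongrightarrow> z" by (simp add: y_def[abs_def])
  moreover have "y n \<in> closure \<Omega>" for n
    using sub dy[of n] closure_subset[of \<Omega>] by auto
  ultimately have "(\<lambda>n. u (y n)) \<longlonglongrightarrow> u z"
    using z(1) by (intro continuous_on_tendsto_compose[OF u]) (simp_all add: frontier_def)
  then have "(\<lambda>n. \<bar>u (y n) - u x\<bar>) \<longlonglongrightarrow> \<bar>u z - u x\<bar>"
    by (intro tendsto_intros)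
  then have "\<bar>u z - u x\<bar> \<le> d"
    by (rule LIMSEQ_le_const2) (use bound in auto)
  then have "\<bar>u x\<bar> \<le> d" using zero[OF z(1)] by simp
  then show ?thesis using sub subset_ball by blast
qed

lemma solution_weak_grad:
  fixes \<Omega> :: "'a::euclidean_space set"
  assumes "is_solution \<Omega> h lam mu u"
  shows "has_weak_grad \<Omega> u (weak_grad \<Omega> u)"
    and "AE x in lebesgue_on \<Omega>. norm (weak_grad \<Omega> u x) \<le> 1"
proof -
  have "\<exists>G. has_weak_grad \<Omega> u G"
    using assms by (auto simp: is_solution_def W2p_def)
  then show "has_weak_grad \<Omega> u (weak_grad \<Omega> u)"
    unfolding weak_grad_def by (rule someI_ex)
  have "AE x in lebesgue_on \<Omega>. ereal (norm (weak_grad \<Omega> u x)) \<le> Linf_norm \<Omega> (weak_grad \<Omega> u)"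
    unfolding Linf_norm_def by (rule esssup_AE)
  moreover have less: "Linf_norm \<Omega> (weak_grad \<Omega> u) < 1" using assms by (simp add: is_solution_def)
  ultimately show "AE x in lebesgue_on \<Omega>. norm (weak_grad \<Omega> u x) \<le> 1"
  proof (elim eventually_mono)
    fix x assume "ereal (norm (weak_grad \<Omega> u x)) \<le> Linf_norm \<Omega> (weak_grad \<Omega> u)"
    then have "ereal (norm (weak_grad \<Omega> u x)) < 1" using less by (rule order.strict_trans1)
    then show "norm (weak_grad \<Omega> u x) \<le> 1" by (simp add: one_ereal_def)
  qed
qed

lemma solution_lipschitz:
  fixes \<Omega> :: "'a::euclidean_space set"
  assumes sol: "is_solution \<Omega> h lam mu u" and \<Omega>: "open \<Omega>" and seg: "closed_segment p q \<subseteq> \<Omega>"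
  shows "\<bar>u q - u p\<bar> \<le> dist p q"
proof -
  have "continuous_on \<Omega> u"
    using sol continuous_on_subset[OF _ closure_subset] by (auto simp: is_solution_def)
  then show ?thesis
    using weak_grad_bound_imp_lipschitz[OF solution_weak_grad[OF sol] \<Omega> _ seg] by simp
qed

lemma solution_ball_subset:
  fixes \<Omega> :: "'a::euclidean_space set"
  assumes sol: "is_solution \<Omega> h lam mu u" and \<Omega>: "open \<Omega>" "bounded \<Omega>" and "x \<in> \<Omega>"
  shows "ball x \<bar>u x\<bar> \<subseteq> \<Omega>"
  using sol solution_lipschitz[OF sol \<Omega>(1)] \<Omega> \<open>x \<in> \<Omega>\<close>
  by (intro ball_abs_value_subset) (auto simp: is_solution_def)

text \<open>An open set is a countable union of closed boxes, and integrability on each of them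
  includes measurability there.\<close>

lemma locally_integrable_imp_measurable:
  fixes \<Omega> :: "'a::euclidean_space set" and f :: "'a \<Rightarrow> real"
  assumes "open \<Omega>" "locally_integrable \<Omega> f"
  shows "f \<in> borel_measurable (lebesgue_on \<Omega>)"
proof -
  obtain D :: "'a set set" where D: "countable D" "D \<subseteq> Pow \<Omega>" "\<And>X. X \<in> D \<Longrightarrow> \<exists>a b. X = cbox a b" "\<Union>D = \<Omega>"
    using open_countable_Union_open_cbox[OF assms(1)] by metis
  have \<Omega>s: "\<Omega> \<in> sets lebesgue" using assms(1) by auto
  have Xs: "X \<in> sets lebesgue" "\<Omega> \<inter> X = X" if X: "X \<in> D" for X
  proof -
    obtain a b where "X = cbox a b" using D(3)[OF X] by blast
    then show "X \<in> sets lebesgue" by simp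
    show "\<Omega> \<inter> X = X" using X D(2) by auto
  qed
  show ?thesis
  proof (rule measurable_piecewise_restrict[OF D(1)])
    show "space (lebesgue_on \<Omega>) \<subseteq> \<Union>D" using D(4) by simp
    fix X assume X: "X \<in> D"
    show "X \<inter> space (lebesgue_on \<Omega>) \<in> sets (lebesgue_on \<Omega>)"
      using Xs[OF X] \<Omega>s by (subst sets_restrict_space_iff) auto
    obtain a b where ab: "X = cbox a b" using D(3)[OF X] by blast
    then have "f absolutely_integrable_on X"
      using assms(2) X D(2) by (auto simp: locally_integrable_def)
    then have "f \<in> borel_measurable (lebesgue_on X)"
      using absolutely_integrable_imp_integrable[OF _ Xs(1)[OF X]] borel_measurable_integrable by blast
    then show "f \<in> restrict_space (lebesgue_on \<Omega>) X \<rightarrow>\<^sub>M borel"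
      using Xs[OF X] \<Omega>s by (simp add: restrict_restrict_space)
  qed
qed

lemma continuous_closure_measurable:
  assumes "open \<Omega>" "continuous_on (closure \<Omega>) u"
  shows "u \<in> borel_measurable (lebesgue_on \<Omega>)"
  using assms continuous_on_subset[OF _ closure_subset]
  by (intro continuous_imp_measurable_on_sets_lebesgue) auto

text \<open>Without this the functional would be infinite at solutions, and no upper bound for the energy
  could hold.\<close>

lemma solution_in_K0:
  fixes \<Omega> :: "'a::euclidean_space set"
  assumes sol: "is_solution \<Omega> h lam mu u" and \<Omega>: "open \<Omega>" "bounded \<Omega>"
  shows "u \<in> K0 \<Omega>"
proof -
  have cont: "continuous_on (closure \<Omega>) u" and less: "Linf_norm \<Omega> (weak_grad \<Omega> u) < 1"
    and zero: "\<forall>x\<in>frontier \<Omega>. u x = 0"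
    using sol by (auto simp: is_solution_def)
  have "compact (u ` closure \<Omega>)"
    using cont \<Omega>(2) by (intro compact_continuous_image) (simp_all add: compact_closure)
  then obtain B where B: "\<And>x. x \<in> closure \<Omega> \<Longrightarrow> norm (u x) \<le> B"
    using compact_imp_bounded bounded_iff by (metis imageI)
  have um: "u \<in> borel_measurable (lebesgue_on \<Omega>)"
    by (rule continuous_closure_measurable[OF \<Omega>(1) cont])
  have "AE x in lebesgue_on \<Omega>. ereal (norm (u x)) \<le> ereal B"
    using B closure_subset[of \<Omega>] by (intro AE_I2) auto
  then have "Linf_norm \<Omega> u \<le> ereal B"
    unfolding Linf_norm_def using um by (intro esssup_I) measurable
  then have "Linf \<Omega> u"
    unfolding Linf_def using um le_less_trans[of "Linf_norm \<Omega> u" "ereal B" \<infinity>] by simp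
  moreover have "weak_grad \<Omega> u \<in> borel_measurable (lebesgue_on \<Omega>)"
  proof (subst borel_measurable_euclidean_space, intro ballI)
    fix i :: 'a assume "i \<in> Basis"
    then have "locally_integrable \<Omega> (\<lambda>x. weak_grad \<Omega> u x \<bullet> i)"
      using solution_weak_grad(1)[OF sol] by (simp add: has_weak_grad_def has_weak_partial_def)
    then show "(\<lambda>x. weak_grad \<Omega> u x \<bullet> i) \<in> borel_measurable (lebesgue_on \<Omega>)"
      by (rule locally_integrable_imp_measurable[OF \<Omega>(1)])
  qed
  then have "Linf \<Omega> (weak_grad \<Omega> u)"
    unfolding Linf_def using less by (auto intro: less_trans)
  ultimately have "W1inf \<Omega> u"
    unfolding W1inf_def using solution_weak_grad(1)[OF sol] by blast
  then show ?thesis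
    unfolding K0_def using cont less zero by (simp add: less_imp_le)
qed

lemma Psi_solution_le:
  fixes \<Omega> :: "'a::euclidean_space set"
  assumes sol: "is_solution \<Omega> h lam mu u" and \<Omega>: "open \<Omega>" "bounded \<Omega>"
  shows "Psi \<Omega> u \<le> ereal (measure lebesgue \<Omega>)"
proof -
  have lm: "\<Omega> \<in> lmeasurable" using \<Omega> by (intro lmeasurable_open)
  have "(\<integral>x. 1 - sqrt (1 - (norm (weak_grad \<Omega> u x))\<^sup>2) \<partial>lebesgue_on \<Omega>)
      \<le> (\<integral>x. 1 \<partial>lebesgue_on \<Omega>)"
  proof (rule integral_mono_AE')
    show "AE x in lebesgue_on \<Omega>. 1 - sqrt (1 - (norm (weak_grad \<Omega> u x))\<^sup>2) \<le> 1"
      using solution_weak_grad(2)[OF sol]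
    proof (rule eventually_mono)
      fix x assume "norm (weak_grad \<Omega> u x) \<le> 1"
      then have "(norm (weak_grad \<Omega> u x))\<^sup>2 \<le> 1" by (simp add: power_le_one)
      then show "1 - sqrt (1 - (norm (weak_grad \<Omega> u x))\<^sup>2) \<le> 1" by simp
    qed
    show "integrable (lebesgue_on \<Omega>) (\<lambda>x. 1::real)"
      by (intro finite_measure.integrable_const finite_measure_lebesgue_on lm)
  qed simp
  also have "\<dots> = measure lebesgue \<Omega>"
    using lm by (simp add: measure_restrict_space fmeasurableD)
  finally show ?thesis
    using solution_in_K0[OF assms] by (simp add: Psi_def)
qed

section \<open>Energy and concentration\<close>

lemma solution_abs_le:
  fixes \<Omega> :: "'a::euclidean_space set"
  assumes sol: "is_solution \<Omega> h lam mu u" and \<Omega>: "open \<Omega>" "\<Omega> \<subseteq> cball 0 B" and x: "x \<in> \<Omega>"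
  shows "\<bar>u x\<bar> \<le> B"
proof -
  have bdd: "bounded \<Omega>" using bounded_subset[OF bounded_cball \<Omega>(2)] .
  have "ball x \<bar>u x\<bar> \<subseteq> cball 0 B"
    using solution_ball_subset[OF sol \<Omega>(1) bdd x] \<Omega>(2) by (rule order_trans)
  then have "dist x 0 + \<bar>u x\<bar> \<le> B \<or> \<bar>u x\<bar> \<le> 0"
    by (simp only: ball_subset_cball_iff)
  moreover have "norm x \<le> B" using x \<Omega>(2) by auto
  moreover have "0 \<le> norm x" by simp
  ultimately show ?thesis unfolding dist_0_norm dist_commute[of x 0] by linarith
qed

text \<open>Everything in the energy except the term with \<open>mu\<close> is bounded by a constant that does not
  depend on \<open>mu\<close> and on the solution: the integrand of \<open>Psi\<close> is at most \<open>1\<close>, and \<open>u\<close> is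
  bounded by the radius of a ball around the domain.\<close>

lemma energy_solution_le:
  fixes \<Omega> :: "'a::euclidean_space set"
  assumes sol: "is_solution \<Omega> h lam mu u" and \<Omega>: "open \<Omega>" "\<Omega> \<subseteq> cball 0 B"
  shows "energy \<Omega> h lam mu u \<le> ereal ((1 + \<bar>lam\<bar> / 2 * B\<^sup>2) * measure lebesgue \<Omega>
           - mu * (\<integral>x. primitive h x (u x) \<partial>lebesgue_on \<Omega>))"
proof -
  have bdd: "bounded \<Omega>" using bounded_subset[OF bounded_cball \<Omega>(2)] .
  have lm: "\<Omega> \<in> lmeasurable" using \<Omega> bdd by (intro lmeasurable_open)
  define Q where "Q = (\<integral>x. (u x)\<^sup>2 \<partial>lebesgue_on \<Omega>)"
  define P where "P = mu * (\<integral>x. primitive h x (u x) \<partial>lebesgue_on \<Omega>)"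
  have "Q \<le> (\<integral>x. B\<^sup>2 \<partial>lebesgue_on \<Omega>)"
    unfolding Q_def
  proof (rule integral_mono_AE')
    show "AE x in lebesgue_on \<Omega>. (u x)\<^sup>2 \<le> B\<^sup>2"
    proof (rule AE_I2)
      fix x assume "x \<in> space (lebesgue_on \<Omega>)"
      then have "\<bar>u x\<bar> \<le> B" using solution_abs_le[OF sol \<Omega>] by simp
      then show "(u x)\<^sup>2 \<le> B\<^sup>2" using power_mono[of "\<bar>u x\<bar>" B 2] by simp
    qed
    show "integrable (lebesgue_on \<Omega>) (\<lambda>x. B\<^sup>2)"
      by (intro finite_measure.integrable_const finite_measure_lebesgue_on lm)
  qed simp
  then have Q: "Q \<le> B\<^sup>2 * measure lebesgue \<Omega>"
    using lm by (simp add: measure_restrict_space fmeasurableD mult.commute)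
  have Q0: "Q \<ge> 0" unfolding Q_def by simp
  have "- (lam / 2 * Q) \<le> \<bar>lam\<bar> / 2 * Q" using mult_right_mono[OF _ Q0, of "- (lam / 2)" "\<bar>lam\<bar> / 2"] by simp
  also have "\<dots> \<le> \<bar>lam\<bar> / 2 * (B\<^sup>2 * measure lebesgue \<Omega>)" using Q by (intro mult_left_mono) simp_all
  finally have lamQ: "- (lam / 2 * Q) \<le> \<bar>lam\<bar> / 2 * (B\<^sup>2 * measure lebesgue \<Omega>)" .
  have "energy \<Omega> h lam mu u = Psi \<Omega> u - ereal (lam / 2 * Q) - ereal P"
    by (simp only: energy_def Q_def P_def)
  also have "\<dots> \<le> ereal (measure lebesgue \<Omega>) - ereal (lam / 2 * Q) - ereal P"
    by (intro ereal_minus_mono Psi_solution_le[OF sol \<Omega>(1) bdd] order_refl)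
  also have "\<dots> \<le> ereal ((1 + \<bar>lam\<bar> / 2 * B\<^sup>2) * measure lebesgue \<Omega> - P)"
    using lamQ by (simp add: algebra_simps)
  finally show ?thesis by (simp only: P_def)
qed

text \<open>If \<open>u x\<close> has modulus at least \<open>2 * r\<close>, the Lipschitz estimate keeps \<open>u\<close> beyond \<open>r\<close> or below \<open>- r\<close>
  on the whole ball of radius \<open>r\<close> around \<open>x\<close>, and there the monotonicity of the primitive away from
  \<open>0\<close> bounds it below by \<open>\<eta>\<close>. Elsewhere it is nonnegative. The lower bound thus depends on the solution
  only through \<open>x\<close>.\<close>

lemma integral_primitive_ge:
  fixes \<Omega> :: "'a::euclidean_space set"
  assumes sol: "is_solution \<Omega> h lam mu u" and \<Omega>: "open \<Omega>" "\<Omega> \<subseteq> cball 0 B"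
    and h1: "hyp_h1 \<Omega> h" and h2: "hyp_h2' \<Omega> h"
    and \<eta>: "\<eta> = (\<lambda>y. min (primitive h y r) (primitive h y (- r)))"
      "integrable (lebesgue_on \<Omega>) (\<lambda>y. indicator (ball x r) y * \<eta> y)"
    and r: "r > 0" and x: "x \<in> \<Omega>" "\<bar>u x\<bar> \<ge> 2 * r"
  shows "(\<integral>y. indicator (ball x r) y * \<eta> y \<partial>lebesgue_on \<Omega>)
      \<le> (\<integral>y. primitive h y (u y) \<partial>lebesgue_on \<Omega>)"
proof (rule integral_mono_AE)
  have bdd: "bounded \<Omega>" using bounded_subset[OF bounded_cball \<Omega>(2)] .
  have "u \<in> borel_measurable (lebesgue_on \<Omega>)"
    using sol by (intro continuous_closure_measurable \<Omega>) (simp add: is_solution_def)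
  then show "integrable (lebesgue_on \<Omega>) (\<lambda>y. primitive h y (u y))"
    using solution_abs_le[OF sol \<Omega>] by (rule primitive_integrable[OF \<Omega>(1) bdd h1])
  have "AE y in lebesgue_on \<Omega>. continuous_on UNIV (h y)"
    using h1 by (simp add: hyp_h1_def caratheodory_def)
  moreover have "AE y in lebesgue_on \<Omega>. \<forall>s. s \<noteq> 0 \<longrightarrow> h y s * s > 0"
    using h2 by (simp add: hyp_h2'_def)
  ultimately show "AE y in lebesgue_on \<Omega>. indicator (ball x r) y * \<eta> y \<le> primitive h y (u y)"
  proof eventually_elim
    case (elim y)
    have mono: "primitive h y a \<le> primitive h y b" if "(0 \<le> a \<and> a \<le> b) \<or> (b \<le> a \<and> a \<le> 0)" for a b
      using elim that by (intro primitive_mono_away_from_0) auto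
    show ?case
    proof (cases "y \<in> ball x r")
      case True
      have "closed_segment x y \<subseteq> ball x \<bar>u x\<bar>"
        using True x r by (intro closed_segment_subset) auto
      then have "closed_segment x y \<subseteq> \<Omega>"
        using solution_ball_subset[OF sol \<Omega>(1) bdd x(1)] by (rule order_trans)
      then have "\<bar>u y - u x\<bar> \<le> dist x y" by (rule solution_lipschitz[OF sol \<Omega>(1)])
      moreover have "dist x y < r" using True by simp
      ultimately consider "u y \<ge> r" | "u y \<le> - r" using x(2) by linarith
      then show ?thesis
      proof cases
        case 1
        then have "primitive h y r \<le> primitive h y (u y)" using r by (intro mono) simp
        then show ?thesis using True \<eta>(1) by (simp add: min_le_iff_disj)
      next
        case 2
        then have "primitive h y (- r) \<le> primitive h y (u y)" using r by (intro mono) simp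
        then show ?thesis using True \<eta>(1) by (simp add: min_le_iff_disj)
      qed
    next
      case False
      have "primitive h y 0 \<le> primitive h y (u y)" by (rule mono) linarith
      then show ?thesis using False by simp
    qed
  qed
qed (rule \<eta>(2))

text \<open>The lower bound for the energy and \<open>energy_solution_le\<close> force the integral of the primitive
  below \<open>(C - c) / mu\<close>, hence below the constant \<open>\<kappa>\<close> of \<open>integral_over_balls_bounded_below\<close> for large
  \<open>mu\<close>. By \<open>integral_primitive_ge\<close> no solution can then reach the modulus \<open>e = 2 * r\<close> anywhere.\<close>

lemma uniform_limit_of_energy_bounded_below:
  fixes \<Omega> :: "'a::euclidean_space set" and u :: "real \<Rightarrow> 'a \<Rightarrow> real"
  assumes \<Omega>: "open \<Omega>" "bounded \<Omega>" and h1: "hyp_h1 \<Omega> h" and h2: "hyp_h2' \<Omega> h"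
    and sol: "\<And>mu. mu \<ge> M \<Longrightarrow> is_solution \<Omega> h lam mu (u mu)"
    and below: "Liminf at_top (\<lambda>mu. energy \<Omega> h lam mu (u mu)) > - \<infinity>"
  shows "uniform_limit (closure \<Omega>) u (\<lambda>x. 0) at_top"
  unfolding uniform_limit_iff
proof (intro allI impI)
  fix e :: real assume e: "e > 0"
  define r where "r = e / 2"
  have r: "r > 0" "2 * r = e" using e by (simp_all add: r_def)
  obtain B where "\<forall>x\<in>\<Omega>. norm x \<le> B" using \<Omega>(2) by (auto simp: bounded_iff)
  then have B: "\<Omega> \<subseteq> cball 0 B" by (auto simp: subset_iff)
  define C where "C = (1 + \<bar>lam\<bar> / 2 * B\<^sup>2) * measure lebesgue \<Omega>"
  define \<eta> where "\<eta> = (\<lambda>y. min (primitive h y r) (primitive h y (- r)))"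
  have int: "integrable (lebesgue_on \<Omega>) \<eta>"
    unfolding \<eta>_def using r
    by (intro integrable_min primitive_integrable[OF \<Omega> h1, where \<rho> = r]) simp_all
  have "AE y in lebesgue_on \<Omega>. continuous_on UNIV (h y)"
    using h1 by (simp add: hyp_h1_def caratheodory_def)
  moreover have "AE y in lebesgue_on \<Omega>. \<forall>s. s \<noteq> 0 \<longrightarrow> h y s * s > 0"
    using h2 by (simp add: hyp_h2'_def)
  ultimately have pos: "AE y in lebesgue_on \<Omega>. \<eta> y > 0"
  proof eventually_elim
    case (elim y)
    have "primitive h y s > 0" if "s \<noteq> 0" for s
      using elim that by (intro primitive_pos) auto
    then show ?case using r by (simp add: \<eta>_def)
  qed
  obtain \<kappa> where \<kappa>: "\<kappa> > 0" "\<And>x. x \<in> \<Omega> \<Longrightarrow> (\<integral>y. indicator (ball x r) y * \<eta> y \<partial>lebesgue_on \<Omega>) \<ge> \<kappa>"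
    using integral_over_balls_bounded_below[OF \<Omega> int pos r(1)] by (elim exE conjE) blast
  obtain c where c: "ereal c < Liminf at_top (\<lambda>mu. energy \<Omega> h lam mu (u mu))"
    using ereal_dense2[OF below] by (elim exE conjE)
  show "\<forall>\<^sub>F mu in at_top. \<forall>x\<in>closure \<Omega>. dist (u mu x) 0 < e"
    using less_LiminfD[OF c] eventually_ge_at_top[of M] eventually_gt_at_top[of 0]
      eventually_gt_at_top[of "(C - c) / \<kappa>"]
  proof eventually_elim
    case (elim mu)
    note s = sol[OF elim(2)]
    define I where "I = (\<integral>y. primitive h y (u mu y) \<partial>lebesgue_on \<Omega>)"
    have "ereal c < ereal (C - mu * I)"
      using elim(1) energy_solution_le[OF s \<Omega>(1) B] unfolding C_def I_def by (rule less_le_trans)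
    then have "mu * I < C - c" by simp
    also have "C - c < mu * \<kappa>" using elim(4) \<kappa>(1) by (simp add: pos_divide_less_eq)
    finally have small: "I < \<kappa>" using elim(3) by simp
    show ?case
    proof
      fix x assume x: "x \<in> closure \<Omega>"
      show "dist (u mu x) 0 < e"
      proof (cases "x \<in> \<Omega>")
        case False
        then have "x \<in> frontier \<Omega>" using x \<Omega>(1) by (simp add: frontier_def interior_open)
        then have "u mu x = 0" using s by (simp add: is_solution_def)
        then show ?thesis using e by simp
      next
        case True
        show ?thesis
        proof (rule ccontr)
          assume "\<not> dist (u mu x) 0 < e"
          then have big: "\<bar>u mu x\<bar> \<ge> 2 * r" by (simp add: r(2))
          \<comment> \<open>the integral of a non-integrable function is \<open>0\<close> by convention, hence less than \<open>\<kappa>\<close>\<close>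
          have ind: "integrable (lebesgue_on \<Omega>) (\<lambda>y. indicator (ball x r) y * \<eta> y)"
            using \<kappa>(1) \<kappa>(2)[OF True] not_integrable_integral_eq by force
          show False
            using integral_primitive_ge[OF s \<Omega>(1) B h1 h2 \<eta>_def ind r(1) True big] \<kappa>(2)[OF True] small
            by (simp add: I_def)
        qed
      qed
    qed
  qed
qed

theorem proposition2p17:
  fixes \<Omega> :: "'a::euclidean_space set"
    and h :: "'a \<Rightarrow> real \<Rightarrow> real"
    and lam :: real
  assumes "DIM('a) \<ge> 2"
    and "bounded_C2_domain \<Omega>"
    and "hyp_h1 \<Omega> h"
    and "hyp_h2' \<Omega> h"
  shows "(\<forall>(M::real) (u :: real \<Rightarrow> 'a \<Rightarrow> real).
            M > 0 \<longrightarrow>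
            (\<forall>mu\<ge>M. is_solution \<Omega> h lam mu (u mu)) \<longrightarrow>
            Liminf at_top (\<lambda>mu. energy \<Omega> h lam mu (u mu)) > - \<infinity> \<longrightarrow>
            uniform_limit (closure \<Omega>) u (\<lambda>x. 0) at_top)
       \<and> ((\<exists>Z \<in> null_sets lebesgue.
              uniform_limit (\<Omega> - Z) (\<lambda>s x. primitive h x s / s\<^sup>2) (\<lambda>x. 0) (at 0)) \<longrightarrow>
          \<not> dirichlet_eigenvalue \<Omega> lam \<longrightarrow>
          (\<forall>(mubar::real) (u :: real \<Rightarrow> 'a \<Rightarrow> real).
            mubar \<ge> 0 \<longrightarrow>
            (\<forall>mu>mubar. is_solution \<Omega> h lam mu (u mu) \<and>
                         (\<exists>x\<in>\<Omega>. u mu x \<noteq> 0) \<and>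
                         energy \<Omega> h lam mu (u mu) > 0) \<longrightarrow>
            uniform_limit (closure \<Omega>) u (\<lambda>x. 0) at_top))"
proof -
  have \<Omega>: "open \<Omega>" "bounded \<Omega>" using assms(2) by (simp_all add: bounded_C2_domain_def)
  note main = uniform_limit_of_energy_bounded_below[OF \<Omega> assms(3,4), where lam = lam]
  show ?thesis
  proof (intro conjI impI allI)
    fix M :: real and u :: "real \<Rightarrow> 'a \<Rightarrow> real"
    assume "\<forall>mu\<ge>M. is_solution \<Omega> h lam mu (u mu)"
      and "Liminf at_top (\<lambda>mu. energy \<Omega> h lam mu (u mu)) > - \<infinity>"
    then show "uniform_limit (closure \<Omega>) u (\<lambda>x. 0) at_top" by (intro main[of M u]) simp_all
  next
    fix mubar :: real and u :: "real \<Rightarrow> 'a \<Rightarrow> real"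
    assume *: "\<forall>mu>mubar. is_solution \<Omega> h lam mu (u mu) \<and> (\<exists>x\<in>\<Omega>. u mu x \<noteq> 0) \<and>
        energy \<Omega> h lam mu (u mu) > 0"
    \<comment> \<open>positive energies have a nonnegative lower limit, so the first part applies\<close>
    have "0 \<le> Liminf at_top (\<lambda>mu. energy \<Omega> h lam mu (u mu))"
      by (intro Liminf_bounded eventually_mono[OF eventually_gt_at_top[of mubar]])
         (use * in \<open>simp add: less_imp_le\<close>)
    then have "Liminf at_top (\<lambda>mu. energy \<Omega> h lam mu (u mu)) > - \<infinity>"
      by (rule less_le_trans[rotated]) simp
    then show "uniform_limit (closure \<Omega>) u (\<lambda>x. 0) at_top"
      using * by (intro main[of "mubar + 1" u]) simp_all
  qed
qed

end
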